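(* Let $w\in A_{p_0}(\mathbb{R}^{n_1}\times\mathbb{R}^{n_2})$ for some $p_0\in(1,\infty)$. Let $p\in(0,\infty)$, $\mathcal K\subseteq L^p(w)$, and $0<a\le p/p_0$. If $\mathcal K$ is precompact in $L^p(w)$, then the following hold: (a) $\sup_{f\in\mathcal K}\|f\|_{L^p(w)}<\infty$; (b) $\lim_{A\to\infty}\sup_{f\in\mathcal K}\|f\mathbf 1_{B_{\vec n}(0,A)^c}\|_{L^p(w)}=0$; (c) $\displaystyle\lim_{r\to0}\sup_{f\in\mathcal K}\Big\|\Big[\frac1{|B_{\vec n}(0,r)|}\int_{B_{\vec n}(0,r)}|(\tau_y-\tau_{y_1}-\tau_{y_2}+I)f|^a\,dy\Big]^{1/a}\Big\|_{L^p(w)}=0$.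
   Context: A weight is a measurable function $w$ with $0<w<\infty$ a.e. on $\mathbb{R}^{n_1}\times\mathbb{R}^{n_2}$. For $q\in(1,\infty)$, $w\in A_q(\mathbb{R}^{n_1}\times\mathbb{R}^{n_2})$ iff $\sup_R\big(\frac1{|R|}\int_Rw\big)\big(\frac1{|R|}\int_Rw^{1-q'}\big)^{q-1}<\infty$, the supremum over all rectangles $R=I^1\times I^2$ with $I^i$ a cube in $\mathbb{R}^{n_i}$. $\|f\|_{L^p(w)}=(\int|f|^pw)^{1/p}$. $B_{\vec n}(x,r)=\{y=(y_1,y_2)\in\mathbb{R}^{n_1}\times\mathbb{R}^{n_2}:|y_1-x_1|+|y_2-x_2|<r\}$, and for $y=(y_1,y_2)$, $(\tau_y-\tau_{y_1}-\tau_{y_2}+I)f(x)=f(x_1-y_1,x_2-y_2)-f(x_1-y_1,x_2)-f(x_1,x_2-y_2)+f(x_1,x_2)$. *)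

theory Defs
  imports "HOL-Analysis.Analysis"
begin

text \<open>
  Real powers of extended nonnegative numbers, with the usual conventions
  $0^s = \infty$ and $\infty^s = 0$ for $s < 0$.
\<close>

definition epowr :: "ennreal \<Rightarrow> real \<Rightarrow> ennreal" where
  "epowr x s =
     (if s = 0 then 1
      else if x = 0 then (if s < 0 then top else 0)
      else if x = top then (if s < 0 then 0 else top)
      else ennreal (enn2real x powr s))"

definition eaverage :: "'a::euclidean_space set \<Rightarrow> ('a \<Rightarrow> ennreal) \<Rightarrow> ennreal" where
  "eaverage E g = (\<integral>\<^sup>+y\<in>E. g y \<partial>lebesgue) / emeasure lebesgue E"

definition cubes :: "(real ^ 'n) set set" where
  "cubes = {cbox c (\<chi> i. c $ i + l) | c l. l > 0}"

definition rectangles :: "((real ^ 'n1) \<times> (real ^ 'n2)) set set" where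
  "rectangles = {I1 \<times> I2 | I1 I2. I1 \<in> cubes \<and> I2 \<in> cubes}"

definition weight :: "('a::euclidean_space \<Rightarrow> ennreal) \<Rightarrow> bool" where
  "weight w \<longleftrightarrow> w \<in> borel_measurable lebesgue \<and> (AE x in lebesgue. 0 < w x \<and> w x < top)"

text \<open>
  In the second average, $q / (q - 1)$ is the conjugate exponent $q'$.
\<close>

definition product_Ap :: "real \<Rightarrow> ((real ^ 'n1) \<times> (real ^ 'n2) \<Rightarrow> ennreal) set" where
  "product_Ap q = {w. weight w \<and>
     (SUP R\<in>rectangles.
        eaverage R w * epowr (eaverage R (\<lambda>x. epowr (w x) (1 - q / (q - 1)))) (q - 1)) < top}"

text \<open>
  The norm is \<open>ennreal\<close>-valued, and is defined on \<open>ennreal\<close>-valued functions, so that it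
  is meaningful (possibly infinite) for every measurable function.
\<close>

definition eLp_norm :: "real \<Rightarrow> ('a::euclidean_space \<Rightarrow> ennreal) \<Rightarrow> ('a \<Rightarrow> ennreal) \<Rightarrow> ennreal" where
  "eLp_norm p w g = epowr (\<integral>\<^sup>+x. epowr (g x) p * w x \<partial>lebesgue) (1 / p)"

definition Lp_norm :: "real \<Rightarrow> ('a::euclidean_space \<Rightarrow> ennreal) \<Rightarrow> ('a \<Rightarrow> complex) \<Rightarrow> ennreal" where
  "Lp_norm p w f = eLp_norm p w (\<lambda>x. ennreal (norm (f x)))"

definition Lp_space :: "real \<Rightarrow> ('a::euclidean_space \<Rightarrow> ennreal) \<Rightarrow> ('a \<Rightarrow> complex) set" where
  "Lp_space p w = {f. f \<in> borel_measurable lebesgue \<and> Lp_norm p w f < top}"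

text \<open>
  Elements of $L^p(w)$ are represented by functions rather than by almost-everywhere classes.
  The topology below is the (non-Hausdorff) pullback of the usual topology on classes; its open
  and closed sets are unions of classes, so closures and compactness correspond to those in the
  quotient.  For $p < 1$ the functional \<open>Lp_norm\<close> is only a quasi-norm; a set is open iff it
  contains a quasi-norm ball around each of its points.
\<close>

definition Lp_topology ::
    "real \<Rightarrow> ('a::euclidean_space \<Rightarrow> ennreal) \<Rightarrow> ('a \<Rightarrow> complex) topology" where
  "Lp_topology p w = topology (\<lambda>U. U \<subseteq> Lp_space p w \<and>
     (\<forall>f\<in>U. \<exists>e>0. \<forall>g\<in>Lp_space p w. Lp_norm p w (\<lambda>x. g x - f x) < e \<longrightarrow> g \<in> U))"

lemma openin_Lp_topology:
  "openin (Lp_topology p w) U \<longleftrightarrow> U \<subseteq> Lp_space p w \<and>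
     (\<forall>f\<in>U. \<exists>e>0. \<forall>g\<in>Lp_space p w. Lp_norm p w (\<lambda>x. g x - f x) < e \<longrightarrow> g \<in> U)"
proof -
  let ?L = "\<lambda>U. U \<subseteq> Lp_space p w \<and>
     (\<forall>f\<in>U. \<exists>e>0. \<forall>g\<in>Lp_space p w. Lp_norm p w (\<lambda>x. g x - f x) < e \<longrightarrow> g \<in> U)"
  have "istopology ?L"
    unfolding istopology_def
  proof (intro conjI allI impI)
    fix S T assume S: "?L S" and T: "?L T"
    show "S \<inter> T \<subseteq> Lp_space p w" using S by blast
    show "\<forall>f\<in>S \<inter> T. \<exists>e>0. \<forall>g\<in>Lp_space p w. Lp_norm p w (\<lambda>x. g x - f x) < e \<longrightarrow> g \<in> S \<inter> T"
    proof
      fix f assume f: "f \<in> S \<inter> T"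
      obtain d where d: "d > 0" "\<forall>g\<in>Lp_space p w. Lp_norm p w (\<lambda>x. g x - f x) < d \<longrightarrow> g \<in> S"
        using S f by blast
      obtain e where e: "e > 0" "\<forall>g\<in>Lp_space p w. Lp_norm p w (\<lambda>x. g x - f x) < e \<longrightarrow> g \<in> T"
        using T f by blast
      show "\<exists>e>0. \<forall>g\<in>Lp_space p w. Lp_norm p w (\<lambda>x. g x - f x) < e \<longrightarrow> g \<in> S \<inter> T"
        using d e by (intro exI[of _ "min d e"]) auto
    qed
  next
    fix \<U> assume U: "\<forall>U\<in>\<U>. ?L U"
    show "\<Union>\<U> \<subseteq> Lp_space p w" using U by blast
    show "\<forall>f\<in>\<Union>\<U>. \<exists>e>0. \<forall>g\<in>Lp_space p w. Lp_norm p w (\<lambda>x. g x - f x) < e \<longrightarrow> g \<in> \<Union>\<U>"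
      using U by (meson UnionE UnionI)
  qed
  then show ?thesis
    by (simp add: Lp_topology_def)
qed

lemma topspace_Lp_topology: "topspace (Lp_topology p w) = Lp_space p w"
proof
  show "topspace (Lp_topology p w) \<subseteq> Lp_space p w"
    using openin_Lp_topology[of p w] openin_topspace by blast
  have "openin (Lp_topology p w) (Lp_space p w)"
    unfolding openin_Lp_topology using zero_less_one by blast
  then show "Lp_space p w \<subseteq> topspace (Lp_topology p w)"
    by (rule openin_subset)
qed

definition precompact_in :: "'a topology \<Rightarrow> 'a set \<Rightarrow> bool" where
  "precompact_in X K \<longleftrightarrow> K \<subseteq> topspace X \<and> compactin X (X closure_of K)"

definition sum_ball ::
    "'a::real_normed_vector \<times> 'b::real_normed_vector \<Rightarrow> real \<Rightarrow> ('a \<times> 'b) set" where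
  "sum_ball x r = {y. norm (fst y - fst x) + norm (snd y - snd x) < r}"

definition mixed_diff ::
    "'a::ab_group_add \<times> 'b::ab_group_add \<Rightarrow> ('a \<times> 'b \<Rightarrow> complex) \<Rightarrow> 'a \<times> 'b \<Rightarrow> complex" where
  "mixed_diff y f x =
     f (fst x - fst y, snd x - snd y) - f (fst x - fst y, snd x) - f (fst x, snd x - snd y)
     + f (fst x, snd x)"

end

theory Submission
  imports Defs
begin

text \<open>
  Write \<open>D f = \<integral> |f|^p w\<close>, so that the norm of \<open>f\<close> is \<open>D f\<close> to the power \<open>1/p\<close>.  The elementary
  inequality \<open>(x + y)^p \<le> (1 + \<eta>)^p x^p + (1 + 1/\<eta>)^p y^p\<close>, valid for all \<open>p > 0\<close>, replaces the
  triangle inequality throughout and spares a distinction between \<open>p \<ge> 1\<close> and \<open>p < 1\<close>.  With \<open>\<eta>\<close>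
  small it shows that the sets \<open>{f. D (f - g) < \<epsilon>}\<close> are open, so a precompact set is covered by
  finitely many of them.  Since \<open>w\<close> is locally integrable, continuous functions with bounded support
  are dense, and the centres may be taken among them (\<open>precompact_Cc_net\<close>).  All three assertions are
  now checked on the finitely many centres and transferred to the whole set; this is immediate for the
  bound on the norms and for the decay at infinity.

  For the mixed differences two more facts are needed.  For a continuous function with bounded support
  the averages tend to zero by uniform continuity (\<open>mixed_osc_Cc_small\<close>).  To transfer this to nearby
  functions, the \<open>p\<close>-th power of the norm of the averaged mixed difference must be bounded by \<open>D\<close>,
  uniformly in \<open>r\<close> (\<open>mixed_osc_le_power_integral\<close>).  By the power mean inequality, the exponent \<open>a\<close>
  may be raised to \<open>p / p0\<close>, after which the claim concerns the boundedness on \<open>L^{p0}(w)\<close> of the four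
  operators that average \<open>g = |f|^{p/p0}\<close> over \<open>x - (k y1, l y2)\<close> with \<open>k, l \<in> {0, r}\<close>.

  \<^item> For \<open>k, l > 0\<close> these are averages over rectangles of one fixed shape, and no maximal function is
    needed: Hoelder's inequality with the dual weight, Tonelli's theorem and a translation reduce
    the bound to the \<open>A_{p0}\<close> condition on a rectangle twice as large (\<open>single_scale_bound\<close>).

  \<^item> If \<open>k\<close> or \<open>l\<close> vanishes, only one of the variables is averaged.  Instead of passing to the
    restrictions of \<open>w\<close> to fibres, which would require differentiation of integrals, one lets \<open>k\<close> or
    \<open>l\<close> tend to zero: the bound does not depend on them, and it survives by Fatou's lemma for
    continuous \<open>g\<close> (\<open>average_bound_limit_map\<close>).

  The bound for continuous functions passes to a general \<open>f\<close> once more by Fatou's lemma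
  (\<open>mixed_osc_Fatou\<close>): if \<open>h n\<close> converges to \<open>f\<close> almost everywhere, then for almost every \<open>x\<close> and almost
  every \<open>y\<close> it converges at all four points of the mixed difference.  This also avoids the measurability
  of the mixed difference of a function that is only Lebesgue measurable.
\<close>

section \<open>Powers of extended nonnegative numbers\<close>

lemma epowr_zero [simp]: "s > 0 \<Longrightarrow> epowr 0 s = 0"
  by (simp add: epowr_def)

lemma epowr_top [simp]: "s > 0 \<Longrightarrow> epowr top s = top"
  by (simp add: epowr_def)

lemma epowr_ennreal: "s > 0 \<Longrightarrow> 0 \<le> t \<Longrightarrow> epowr (ennreal t) s = ennreal (t powr s)"
  by (auto simp: epowr_def)

lemma epowr_ennreal_pos: "0 < t \<Longrightarrow> epowr (ennreal t) s = ennreal (t powr s)"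
  by (auto simp: epowr_def ennreal_eq_0_iff)

lemma epowr_1 [simp]: "epowr x 1 = x"
  by (cases x) (auto simp: epowr_def)

lemma epowr_mono: "s > 0 \<Longrightarrow> x \<le> y \<Longrightarrow> epowr x s \<le> epowr y s"
  by (cases x; cases y) (auto simp: epowr_ennreal powr_mono2 top_unique)

lemma epowr_epowr: "s > 0 \<Longrightarrow> t > 0 \<Longrightarrow> epowr (epowr x s) t = epowr x (s * t)"
  by (cases x) (auto simp: epowr_ennreal powr_powr)

lemma epowr_less_top_iff: "s > 0 \<Longrightarrow> epowr x s < top \<longleftrightarrow> x < top"
  by (cases x) (auto simp: epowr_ennreal)

lemma epowr_less_iff: "s > 0 \<Longrightarrow> epowr x s < epowr y s \<longleftrightarrow> x < y"
proof
  assume s: "s > 0"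
  show "x < y" if "epowr x s < epowr y s"
    using that epowr_mono[OF s, of y x] by (meson not_le)
  show "epowr x s < epowr y s" if "x < y"
  proof (rule ccontr)
    assume "\<not> epowr x s < epowr y s"
    then have "epowr y s \<le> epowr x s" by (simp add: not_less)
    then have "epowr (epowr y s) (1 / s) \<le> epowr (epowr x s) (1 / s)"
      using s by (intro epowr_mono[of "1 / s" "epowr y s"]) auto
    then show False using s that by (simp add: epowr_epowr)
  qed
qed

lemma epowr_mult: "s > 0 \<Longrightarrow> epowr (x * y) s = epowr x s * epowr y s"
proof -
  assume s: "s > 0"
  have top: "epowr (top * z) s = epowr top s * epowr z s" for z
    using s by (cases z; cases "z = 0")
      (auto simp: epowr_ennreal ennreal_top_mult ennreal_eq_0_iff)
  show ?thesis
    using s top[of x] top[of y]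
    by (cases x; cases y) (auto simp: epowr_ennreal powr_mult mult.commute simp flip: ennreal_mult)
qed

text \<open>
  A monotone map of a linear order onto itself has no jumps; the inverse power gives surjectivity.
  This settles the behaviour at \<open>0\<close> and \<open>\<infinity>\<close> without a case distinction.
\<close>

lemma continuous_on_epowr: "s > 0 \<Longrightarrow> continuous_on UNIV (\<lambda>x. epowr x s)"
proof (rule continuous_onI_mono)
  assume s: "s > 0"
  have "range (\<lambda>x. epowr x s) = UNIV"
    using s by (intro surjI[of _ "\<lambda>x. epowr x (1 / s)"]) (simp add: epowr_epowr)
  then show "open (range (\<lambda>x. epowr x s))" by simp
qed (auto intro: epowr_mono)

lemma measurable_epowr [measurable]:
  assumes "s > 0" "f \<in> borel_measurable M"
  shows "(\<lambda>x. epowr (f x) s) \<in> borel_measurable M"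
  using assms(2) borel_measurable_continuous_onI[OF continuous_on_epowr[OF assms(1)]]
  by (rule measurable_compose)

lemma epowr_Liminf:
  "s > 0 \<Longrightarrow> epowr (liminf u) s = liminf (\<lambda>n. epowr (u n) s)"
  by (rule Liminf_compose_continuous_mono[symmetric])
     (auto intro: continuous_on_epowr monoI epowr_mono)

lemma liminf_cmult_ennreal:
  fixes u :: "nat \<Rightarrow> ennreal"
  assumes "c < top"
  shows "c * liminf u = liminf (\<lambda>n. c * u n)"
  using assms by (intro Liminf_compose_continuous_mono[symmetric])
    (auto intro!: ennreal_continuous_on_cmult monoI mult_left_mono)

lemma epowr_add_le:
  assumes "s > 0"
  shows "epowr (x + y) s \<le> ennreal (2 powr s) * (epowr x s + epowr y s)"
proof -
  have "x + y \<le> 2 * max x y"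
    by (simp add: mult_2 add_mono)
  then have "epowr (x + y) s \<le> epowr (2 * max x y) s"
    using assms by (intro epowr_mono)
  also have "\<dots> = ennreal (2 powr s) * epowr (max x y) s"
    using assms epowr_ennreal[of s 2] by (simp add: epowr_mult)
  also have "\<dots> \<le> ennreal (2 powr s) * (epowr x s + epowr y s)"
    by (intro mult_left_mono) (auto simp: max_def)
  finally show ?thesis .
qed

text \<open>
  Either \<open>y\<close> is at most \<open>\<eta> x\<close> and is absorbed into \<open>x\<close>, or \<open>x\<close> is at most \<open>y / \<eta>\<close> and is absorbed into
  \<open>y\<close>.  The factor of \<open>x powr p\<close> can be made arbitrarily close to one, which a cruder quasi-triangle
  inequality does not give and which makes balls open in \<open>openin_Lp_ball\<close>.
\<close>

lemma powr_add_le_split: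
  fixes x y :: real
  assumes "x \<ge> 0" "y \<ge> 0" "p > 0" "\<eta> > 0"
  shows "(x + y) powr p \<le> (1 + \<eta>) powr p * x powr p + (1 + 1 / \<eta>) powr p * y powr p"
proof (cases "y \<le> \<eta> * x")
  case True
  have "(x + y) powr p \<le> ((1 + \<eta>) * x) powr p"
    using assms True by (intro powr_mono2) (auto simp: algebra_simps)
  also have "\<dots> \<le> (1 + \<eta>) powr p * x powr p + (1 + 1 / \<eta>) powr p * y powr p"
    using assms by (simp add: powr_mult)
  finally show ?thesis .
next
  case False
  have "(x + y) powr p \<le> ((1 + 1 / \<eta>) * y) powr p"
    using assms False by (intro powr_mono2) (auto simp: field_simps)
  also have "\<dots> \<le> (1 + \<eta>) powr p * x powr p + (1 + 1 / \<eta>) powr p * y powr p"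
    using assms by (simp add: powr_mult)
  finally show ?thesis .
qed

section \<open>Weighted Hoelder and power mean inequalities\<close>

text \<open>
  Young's inequality for \<open>g v^{1/q}\<close> and \<open>t^{q-1} v^{-1/q}\<close>.  In this form, with the free parameter \<open>t\<close>,
  both sides can be integrated before \<open>t\<close> is chosen.
\<close>

lemma weighted_Young:
  fixes g v t q :: real
  assumes q: "q > 1" and "g \<ge> 0" "v > 0" "t > 0"
  shows "q * t powr (q - 1) * g \<le> g powr q * v + (q - 1) * t powr q * v powr (1 - q / (q - 1))"
proof -
  let ?q' = "q / (q - 1)"
  have "(g * v powr (1 / q)) * (t powr (q - 1) * v powr (- 1 / q))
      \<le> (g * v powr (1 / q)) powr q / q + (t powr (q - 1) * v powr (- 1 / q)) powr ?q' / ?q'"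
    using assms by (intro Youngs_inequality) (auto simp: field_simps)
  moreover have "(g * v powr (1 / q)) powr q = g powr q * v"
    using assms by (simp add: powr_mult powr_powr)
  moreover have "- 1 / q * ?q' = 1 - ?q'"
    using q by (simp add: field_simps)
  then have "(t powr (q - 1) * v powr (- 1 / q)) powr ?q' = t powr q * v powr (1 - ?q')"
    using assms by (simp add: powr_mult powr_powr)
  moreover have "(g * v powr (1 / q)) * (t powr (q - 1) * v powr (- 1 / q)) = t powr (q - 1) * g"
    using assms by (simp add: mult_ac powr_add[symmetric])
  ultimately have "t powr (q - 1) * g \<le> g powr q * v / q + t powr q * v powr (1 - ?q') / ?q'"
    by (simp only:)
  then have "q * (t powr (q - 1) * g) \<le> q * (g powr q * v / q + t powr q * v powr (1 - ?q') / ?q')"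
    using q by (intro mult_left_mono) auto
  also have "\<dots> = g powr q * v + (q - 1) * t powr q * v powr (1 - ?q')"
    using q by (simp add: field_simps)
  finally show ?thesis by (simp add: mult.assoc)
qed

text \<open>
  The weighted form of Hoelder's inequality that is matched to the \<open>A_q\<close> condition, with dual weight
  \<open>v powr (1 - q')\<close>: integrate \<open>weighted_Young\<close> and optimize over \<open>t\<close>.
\<close>

lemma weighted_Hoelder:
  fixes g v :: "'a \<Rightarrow> real"
  assumes q: "q > 1" and [measurable]: "g \<in> borel_measurable M" "v \<in> borel_measurable M"
    and g: "\<And>x. g x \<ge> 0" and v: "\<And>x. v x > 0"
    and S: "(\<integral>\<^sup>+x. v x powr (1 - q / (q - 1)) \<partial>M) < top"
           "(\<integral>\<^sup>+x. v x powr (1 - q / (q - 1)) \<partial>M) \<noteq> 0"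
  shows "epowr (\<integral>\<^sup>+x. g x \<partial>M) q
     \<le> (\<integral>\<^sup>+x. g x powr q * v x \<partial>M) * epowr (\<integral>\<^sup>+x. v x powr (1 - q / (q - 1)) \<partial>M) (q - 1)"
proof -
  define G P where "G = (\<integral>\<^sup>+x. g x \<partial>M)" and "P = (\<integral>\<^sup>+x. g x powr q * v x \<partial>M)"
  obtain s where s: "(\<integral>\<^sup>+x. v x powr (1 - q / (q - 1)) \<partial>M) = ennreal s" "s > 0"
    using S by (cases "\<integral>\<^sup>+x. v x powr (1 - q / (q - 1)) \<partial>M") (auto simp: less_le)
  have key: "ennreal (q * t powr (q - 1)) * G \<le> P + ennreal ((q - 1) * t powr q * s)" if t: "t > 0" for t
  proof -
    have "ennreal (q * t powr (q - 1)) * G = (\<integral>\<^sup>+x. q * t powr (q - 1) * g x \<partial>M)"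
      unfolding G_def using q g by (subst nn_integral_cmult[symmetric]) (auto simp: ennreal_mult)
    also have "\<dots> \<le> (\<integral>\<^sup>+x. g x powr q * v x + (q - 1) * t powr q * v x powr (1 - q / (q - 1)) \<partial>M)"
      using weighted_Young[OF q g v t] by (intro nn_integral_mono ennreal_leI) auto
    also have "\<dots> = (\<integral>\<^sup>+x. ennreal (g x powr q * v x)
          + ennreal ((q - 1) * t powr q) * ennreal (v x powr (1 - q / (q - 1))) \<partial>M)"
      using q v by (intro nn_integral_cong) (auto simp: less_imp_le simp flip: ennreal_mult ennreal_plus)
    also have "\<dots> = P + ennreal ((q - 1) * t powr q) * ennreal s"
      unfolding P_def s(1)[symmetric] by (subst nn_integral_add) (auto simp: nn_integral_cmult)
    finally show ?thesis using q s(2) by (simp add: ennreal_mult)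
  qed
  have "epowr G q \<le> P * epowr (ennreal s) (q - 1)"
  proof (cases "P = top")
    case True
    then show ?thesis using s q by (simp add: epowr_ennreal ennreal_top_mult)
  next
    case False
    then obtain \<pi> where \<pi>: "P = ennreal \<pi>" "\<pi> \<ge> 0"
      by (cases P) auto
    have "G \<noteq> top"
      using key[of 1] q s \<pi> by (auto simp: ennreal_mult_top top_unique simp flip: ennreal_plus)
    then obtain \<gamma> where \<gamma>: "G = ennreal \<gamma>" "\<gamma> \<ge> 0"
      by (cases G) auto
    have "\<gamma> powr q \<le> \<pi> * s powr (q - 1)"
    proof (cases "\<gamma> = 0")
      case True
      then show ?thesis using \<pi> s by auto
    next
      case False
      \<comment> \<open>the best \<open>t\<close> is the mean of \<open>g\<close> against the dual density\<close>
      define t where "t = \<gamma> / s"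
      have t: "t > 0" "\<gamma> = t * s" using False \<gamma> s by (auto simp: t_def)
      have "ennreal (q * t powr (q - 1) * \<gamma>) \<le> ennreal (\<pi> + (q - 1) * t powr q * s)"
        using key[OF t(1)] q s \<gamma> \<pi> by (simp add: ennreal_mult)
      then have "q * t powr (q - 1) * \<gamma> \<le> \<pi> + (q - 1) * t powr q * s"
        using q s \<pi> by (subst (asm) ennreal_le_iff) auto
      moreover have "t powr (q - 1) * \<gamma> = t powr q * s"
        using t by (simp add: powr_diff)
      ultimately have "t powr q * s \<le> \<pi>"
        by (simp only: mult.assoc) (simp add: algebra_simps)
      then have "t powr q * s * s powr (q - 1) \<le> \<pi> * s powr (q - 1)"
        by (intro mult_right_mono) auto
      then show ?thesis
        using t s by (simp add: powr_mult powr_diff)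
    qed
    then show ?thesis
      using q s \<pi> \<gamma> by (simp add: epowr_ennreal ennreal_leI flip: ennreal_mult)
  qed
  then show ?thesis by (simp add: G_def P_def s(1))
qed

text \<open>
  The case \<open>v = 1\<close> of \<open>weighted_Hoelder\<close>.
\<close>

lemma power_mean:
  fixes g :: "'a \<Rightarrow> real"
  assumes \<kappa>: "\<kappa> \<ge> 1" and [measurable]: "g \<in> borel_measurable M" and g: "\<And>x. g x \<ge> 0"
    and m: "emeasure M (space M) = ennreal m" "m > 0"
  shows "epowr ((\<integral>\<^sup>+x. g x \<partial>M) / emeasure M (space M)) \<kappa>
     \<le> (\<integral>\<^sup>+x. g x powr \<kappa> \<partial>M) / emeasure M (space M)"
proof (cases "\<kappa> = 1")
  case True
  then show ?thesis using g by simp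
next
  case False
  then have \<kappa>: "\<kappa> > 1" using \<kappa> by simp
  have "epowr (\<integral>\<^sup>+x. g x \<partial>M) \<kappa> \<le> (\<integral>\<^sup>+x. g x powr \<kappa> \<partial>M) * epowr (ennreal m) (\<kappa> - 1)"
    using weighted_Hoelder[of \<kappa> g M "\<lambda>_. 1"] g \<kappa> m by auto
  then have "epowr (\<integral>\<^sup>+x. g x \<partial>M) \<kappa> * epowr (ennreal (1 / m)) \<kappa>
      \<le> (\<integral>\<^sup>+x. g x powr \<kappa> \<partial>M) * epowr (ennreal m) (\<kappa> - 1) * epowr (ennreal (1 / m)) \<kappa>"
    by (intro mult_right_mono) auto
  also have "\<dots> = (\<integral>\<^sup>+x. g x powr \<kappa> \<partial>M) * ennreal (1 / m)"
    using \<kappa> m by (simp add: epowr_ennreal mult.assoc powr_divide powr_diff flip: ennreal_mult)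
  finally show ?thesis
    using \<kappa> m by (simp add: epowr_mult[symmetric] divide_ennreal_def inverse_ennreal inverse_eq_divide)
qed

section \<open>Averages at a single scale\<close>

lemma nn_integral_lborel_translate:
  fixes f :: "'a::euclidean_space \<Rightarrow> ennreal"
  assumes [measurable]: "f \<in> borel_measurable borel"
  shows "(\<integral>\<^sup>+x. f (c + x) \<partial>lborel) = (\<integral>\<^sup>+x. f x \<partial>lborel)"
  by (subst (2) lborel_distr_plus[of c, symmetric]) (simp add: nn_integral_distr)

lemma nn_integral_lborel_reflect:
  fixes f :: "'a::euclidean_space \<Rightarrow> ennreal"
  assumes [measurable]: "f \<in> borel_measurable borel"
  shows "(\<integral>\<^sup>+x. f (c - x) \<partial>lborel) = (\<integral>\<^sup>+x. f x \<partial>lborel)"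
  by (subst (2) lborel_affine[of "-1" c])
     (simp_all add: nn_integral_density nn_integral_distr)

text \<open>
  For every \<open>x\<close>, Hoelder's inequality bounds the \<open>q\<close>-th power of the average of \<open>g\<close> by the average of
  \<open>g^q v\<close> times \<open>S x powr (q - 1)\<close>, where \<open>S x\<close> is the integral of the dual weight \<open>\<sigma>\<close> over \<open>x - T Q\<close>.
  After multiplication by \<open>v x\<close>, exchanging the integrals and substituting \<open>x = z + T y\<close> leaves
  \<open>g z powr q * v z\<close> against the integral over \<open>y \<in> Q\<close> of \<open>v (z + T y) * S (z + T y) powr (q - 1)\<close>.
  As \<open>Q'\<close> contains the differences of points of \<open>Q\<close>, both factors are controlled by integrals over
  \<open>z + T Q'\<close>, and the Muckenhoupt-type hypothesis at the single point \<open>z\<close> applies.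

  The map \<open>T\<close> carries the shape of the rectangles; a weight in \<open>A_q\<close> admits one constant \<open>C\<close> for all
  shapes.
\<close>

lemma single_scale_bound:
  fixes T :: "'b::euclidean_space \<Rightarrow> 'a::euclidean_space" and v g :: "'a \<Rightarrow> real"
    and Q Q' :: "'b set" and C :: ennreal and q :: real
  defines "\<sigma> \<equiv> \<lambda>x. v x powr (1 - q / (q - 1))"
  assumes q: "q > 1" and T: "linear T"
    and [measurable]: "Q \<in> sets borel" "Q' \<in> sets borel"
    and Q: "emeasure lborel Q \<noteq> 0" "0 \<in> Q" "\<And>y y'. y \<in> Q \<Longrightarrow> y' \<in> Q \<Longrightarrow> y - y' \<in> Q'"
    and v [measurable]: "v \<in> borel_measurable borel" and v_pos: "\<And>x. v x > 0"
    and g [measurable]: "g \<in> borel_measurable borel" and g_nonneg: "\<And>x. g x \<ge> 0"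
    and fin: "\<And>z. (\<integral>\<^sup>+u. ennreal (\<sigma> (z + T u)) * indicator Q' u \<partial>lborel) < top"
    and C: "\<And>z. (\<integral>\<^sup>+u. ennreal (v (z + T u)) * indicator Q' u \<partial>lborel)
              * epowr (\<integral>\<^sup>+u. ennreal (\<sigma> (z + T u)) * indicator Q' u \<partial>lborel) (q - 1) \<le> C"
  shows "(\<integral>\<^sup>+x. epowr (\<integral>\<^sup>+y. ennreal (g (x - T y)) * indicator Q y \<partial>lborel) q * ennreal (v x) \<partial>lborel)
     \<le> C * (\<integral>\<^sup>+x. ennreal (g x powr q * v x) \<partial>lborel)"
proof -
  have [measurable]: "T \<in> borel_measurable borel"
    using T by (intro borel_measurable_continuous_onI) (simp add: linear_continuous_on linear_linear)
  have [measurable]: "\<sigma> \<in> borel_measurable borel" unfolding \<sigma>_def by measurable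
  define S S' where "S x = (\<integral>\<^sup>+y. ennreal (\<sigma> (x - T y)) * indicator Q y \<partial>lborel)"
    and "S' z = (\<integral>\<^sup>+u. ennreal (\<sigma> (z + T u)) * indicator Q' u \<partial>lborel)" for x z
  have [measurable]: "S \<in> borel_measurable borel" "S' \<in> borel_measurable borel"
    unfolding S_def[abs_def] S'_def[abs_def] by measurable
  have Q0: "- y \<in> Q'" "y \<in> Q'" if "y \<in> Q" for y
    using Q(3)[OF Q(2) that] Q(3)[OF that Q(2)] by auto
  have S_le: "S (z + T y) \<le> S' z" if "y \<in> Q" for y z
  proof -
    have "S (z + T y) = (\<integral>\<^sup>+y'. ennreal (\<sigma> (z + T (y - y'))) * indicator Q (y - (y - y')) \<partial>lborel)"
      unfolding S_def by (simp add: linear_diff[OF T] algebra_simps)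
    also have "\<dots> = (\<integral>\<^sup>+u. ennreal (\<sigma> (z + T u)) * indicator Q (y - u) \<partial>lborel)"
      by (rule nn_integral_lborel_reflect[where f="\<lambda>u. ennreal (\<sigma> (z + T u)) * indicator Q (y - u)"]) measurable
    also have "\<dots> \<le> S' z"
      unfolding S'_def using Q(3)[OF that, of "y - _"]
      by (intro nn_integral_mono mult_left_mono) (auto split: split_indicator)
    finally show ?thesis .
  qed
  have S_fin: "S x < top" for x
    using S_le[OF Q(2), of x] fin[of x] linear_0[OF T] by (simp add: S'_def le_less_trans)
  have S_pos: "S x \<noteq> 0" for x
  proof
    assume "S x = 0"
    then have "AE y in lborel. y \<notin> Q"
      unfolding S_def by (subst (asm) nn_integral_0_iff_AE) (auto simp: \<sigma>_def v_pos less_imp_neq[OF v_pos, symmetric] split: split_indicator_asm)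
    then have "emeasure lborel Q = 0"
      by (subst (asm) AE_iff_measurable[of Q]) auto
    then show False using Q(1) by simp
  qed
  have Hoelder: "epowr (\<integral>\<^sup>+y. ennreal (g (x - T y)) * indicator Q y \<partial>lborel) q
      \<le> (\<integral>\<^sup>+y. ennreal (g (x - T y) powr q * v (x - T y)) * indicator Q y \<partial>lborel) * epowr (S x) (q - 1)" for x
  proof -
    have *: "(\<integral>\<^sup>+y. ennreal (h y) * indicator Q y \<partial>lborel) = (\<integral>\<^sup>+y. h y \<partial>(restrict_space lborel Q))" for h
      by (simp add: nn_integral_restrict_space)
    show ?thesis
      using weighted_Hoelder[of q "\<lambda>y. g (x - T y)" "restrict_space lborel Q" "\<lambda>y. v (x - T y)"]
        S_fin[of x] S_pos[of x] q g_nonneg v_pos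
      unfolding S_def * \<sigma>_def by (simp add: measurable_restrict_space1)
  qed
  have "(\<integral>\<^sup>+x. epowr (\<integral>\<^sup>+y. ennreal (g (x - T y)) * indicator Q y \<partial>lborel) q * ennreal (v x) \<partial>lborel)
    \<le> (\<integral>\<^sup>+x. (\<integral>\<^sup>+y. ennreal (g (x - T y) powr q * v (x - T y)) * indicator Q y \<partial>lborel) * epowr (S x) (q - 1) * ennreal (v x) \<partial>lborel)"
    by (intro nn_integral_mono mult_right_mono Hoelder) auto
  also have "\<dots> = (\<integral>\<^sup>+x. \<integral>\<^sup>+y. ennreal (g (x - T y) powr q * v (x - T y)) * indicator Q y * (epowr (S x) (q - 1) * ennreal (v x)) \<partial>lborel \<partial>lborel)"
    using q by (subst nn_integral_multc) (auto simp: mult.assoc)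
  also have "\<dots> = (\<integral>\<^sup>+y. \<integral>\<^sup>+x. ennreal (g (x - T y) powr q * v (x - T y)) * indicator Q y * (epowr (S x) (q - 1) * ennreal (v x)) \<partial>lborel \<partial>lborel)"
    using q by (intro lborel_pair.Fubini') measurable
  also have "\<dots> = (\<integral>\<^sup>+y. \<integral>\<^sup>+z. ennreal (g z powr q * v z) * indicator Q y * (epowr (S (z + T y)) (q - 1) * ennreal (v (z + T y))) \<partial>lborel \<partial>lborel)"
  proof (rule nn_integral_cong)
    fix y
    have "(\<integral>\<^sup>+x. ennreal (g (x - T y) powr q * v (x - T y)) * indicator Q y * (epowr (S x) (q - 1) * ennreal (v x)) \<partial>lborel)
       = (\<integral>\<^sup>+z. ennreal (g (T y + z - T y) powr q * v (T y + z - T y)) * indicator Q y * (epowr (S (T y + z)) (q - 1) * ennreal (v (T y + z))) \<partial>lborel)"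
      using q by (intro nn_integral_lborel_translate[where f="\<lambda>x. ennreal (g (x - T y) powr q * v (x - T y)) * indicator Q y * (epowr (S x) (q - 1) * ennreal (v x))", symmetric]) measurable
    then show "(\<integral>\<^sup>+x. ennreal (g (x - T y) powr q * v (x - T y)) * indicator Q y * (epowr (S x) (q - 1) * ennreal (v x)) \<partial>lborel)
       = (\<integral>\<^sup>+z. ennreal (g z powr q * v z) * indicator Q y * (epowr (S (z + T y)) (q - 1) * ennreal (v (z + T y))) \<partial>lborel)"
      by (simp add: add.commute)
  qed
  also have "\<dots> \<le> (\<integral>\<^sup>+y. \<integral>\<^sup>+z. ennreal (g z powr q * v z) * (epowr (S' z) (q - 1) * (ennreal (v (z + T y)) * indicator Q' y)) \<partial>lborel \<partial>lborel)"
    using q S_le Q0 by (intro nn_integral_mono) (auto intro!: mult_mono epowr_mono split: split_indicator)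
  also have "\<dots> = (\<integral>\<^sup>+z. \<integral>\<^sup>+y. ennreal (g z powr q * v z) * (epowr (S' z) (q - 1) * (ennreal (v (z + T y)) * indicator Q' y)) \<partial>lborel \<partial>lborel)"
    using q by (intro lborel_pair.Fubini'[symmetric]) measurable
  also have "\<dots> = (\<integral>\<^sup>+z. ennreal (g z powr q * v z) * ((\<integral>\<^sup>+y. ennreal (v (z + T y)) * indicator Q' y \<partial>lborel) * epowr (S' z) (q - 1)) \<partial>lborel)"
    using q by (subst nn_integral_cmult, simp, subst nn_integral_cmult) (simp_all add: mult.commute)
  also have "\<dots> \<le> (\<integral>\<^sup>+z. ennreal (g z powr q * v z) * C \<partial>lborel)"
    unfolding S'_def by (intro nn_integral_mono mult_left_mono C) auto
  also have "\<dots> = C * (\<integral>\<^sup>+x. ennreal (g x powr q * v x) \<partial>lborel)"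
    by (subst nn_integral_multc) (auto simp: mult.commute)
  finally show ?thesis .
qed

text \<open>
  Fatou's lemma, for the inner and for the outer integral.  Continuity of \<open>g\<close> is essential: for the
  degenerate limits \<open>T\<close> of interest, which project onto one factor, the inner integral sees only null
  sets.
\<close>

lemma average_bound_limit_map:
  fixes T :: "'b::euclidean_space \<Rightarrow> 'a::euclidean_space" and v g :: "'a \<Rightarrow> real"
  assumes q: "q > 0" and [measurable]: "Q \<in> sets borel" "v \<in> borel_measurable borel"
    and g: "continuous_on UNIV g"
    and [measurable]: "\<And>k. Tk k \<in> borel_measurable borel"
    and T: "\<And>y. (\<lambda>k. Tk k y) \<longlonglongrightarrow> T y"
    and le: "\<And>k. (\<integral>\<^sup>+x. epowr (\<integral>\<^sup>+y. ennreal (g (x - Tk k y)) * indicator Q y \<partial>lborel) q * ennreal (v x) \<partial>lborel) \<le> B"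
  shows "(\<integral>\<^sup>+x. epowr (\<integral>\<^sup>+y. ennreal (g (x - T y)) * indicator Q y \<partial>lborel) q * ennreal (v x) \<partial>lborel) \<le> B"
proof -
  have [measurable]: "g \<in> borel_measurable borel" using g by (rule borel_measurable_continuous_onI)
  define M where "M k x = (\<integral>\<^sup>+y. ennreal (g (x - Tk k y)) * indicator Q y \<partial>lborel)" for k x
  have [measurable]: "M k \<in> borel_measurable borel" for k
    unfolding M_def[abs_def] by measurable
  have "epowr (\<integral>\<^sup>+y. ennreal (g (x - T y)) * indicator Q y \<partial>lborel) q * ennreal (v x)
      \<le> liminf (\<lambda>k. epowr (M k x) q * ennreal (v x))" for x
  proof -
    have "ennreal (g (x - T y)) * indicator Q y = liminf (\<lambda>k. ennreal (g (x - Tk k y)) * indicator Q y)" for y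
    proof (rule lim_imp_Liminf[symmetric])
      have "(\<lambda>k. g (x - Tk k y)) \<longlonglongrightarrow> g (x - T y)"
        using g by (intro continuous_on_tendsto_compose[of UNIV g] tendsto_intros T) auto
      then show "(\<lambda>k. ennreal (g (x - Tk k y)) * indicator Q y) \<longlonglongrightarrow> ennreal (g (x - T y)) * indicator Q y"
        by (auto split: split_indicator intro: tendsto_ennrealI)
    qed simp
    then have "(\<integral>\<^sup>+y. ennreal (g (x - T y)) * indicator Q y \<partial>lborel)
        = (\<integral>\<^sup>+y. liminf (\<lambda>k. ennreal (g (x - Tk k y)) * indicator Q y) \<partial>lborel)"
      by simp
    also have "\<dots> \<le> liminf (\<lambda>k. M k x)"
      unfolding M_def by (intro nn_integral_liminf) measurable
    finally have "epowr (\<integral>\<^sup>+y. ennreal (g (x - T y)) * indicator Q y \<partial>lborel) q \<le> liminf (\<lambda>k. epowr (M k x) q)"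
      using q by (simp add: epowr_mono flip: epowr_Liminf)
    then have "epowr (\<integral>\<^sup>+y. ennreal (g (x - T y)) * indicator Q y \<partial>lborel) q * ennreal (v x) \<le> ennreal (v x) * liminf (\<lambda>k. epowr (M k x) q)"
      by (simp add: mult.commute mult_left_mono)
    also have "\<dots> = liminf (\<lambda>k. ennreal (v x) * epowr (M k x) q)"
      by (rule liminf_cmult_ennreal) simp
    finally show ?thesis by (simp add: mult.commute)
  qed
  then have "(\<integral>\<^sup>+x. epowr (\<integral>\<^sup>+y. ennreal (g (x - T y)) * indicator Q y \<partial>lborel) q * ennreal (v x) \<partial>lborel)
      \<le> (\<integral>\<^sup>+x. liminf (\<lambda>k. epowr (M k x) q * ennreal (v x)) \<partial>lborel)"
    by (rule nn_integral_mono)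
  also have "\<dots> \<le> liminf (\<lambda>k. \<integral>\<^sup>+x. epowr (M k x) q * ennreal (v x) \<partial>lborel)"
    using q by (intro nn_integral_liminf) measurable
  also have "\<dots> \<le> liminf (\<lambda>k::nat. B)"
    using le by (intro Liminf_mono always_eventually) (auto simp: M_def)
  finally show ?thesis by (simp add: Liminf_const)
qed

section \<open>Anisotropic dilations and rectangles\<close>

lemma measurable_weight_on_ball:
  fixes v :: "'a::euclidean_space \<Rightarrow> real"
  assumes "v \<in> borel_measurable borel"
  shows "(\<lambda>x. ennreal (v x) * indicator (ball 0 A) x) \<in> borel_measurable borel"
proof -
  have "indicator (ball 0 A) \<in> borel_measurable (borel :: 'a measure)"
    by (intro borel_measurable_indicator) simp
  then show ?thesis
    using assms by (intro borel_measurable_times_ennreal) simp_all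
qed

text \<open>
  With both factors positive, the images of a fixed product of cubes are the rectangles of one shape.
  The factors may also vanish: the four shifts of a mixed difference at scale \<open>r\<close> are
  \<open>dilate k l y\<close> with \<open>k, l \<in> {0, r}\<close>, see \<open>mixed_diff_dilate\<close>.
\<close>

definition dilate :: "real \<Rightarrow> real \<Rightarrow> 'a::real_vector \<times> 'b::real_vector \<Rightarrow> 'a \<times> 'b" where
  "dilate k l y = (k *\<^sub>R fst y, l *\<^sub>R snd y)"

lemma linear_dilate: "linear (dilate k l)"
  by (rule linearI) (auto simp: dilate_def algebra_simps)

lemma measurable_dilate [measurable]:
  "dilate k l \<in> borel_measurable (borel :: ('a::euclidean_space \<times> 'b::euclidean_space) measure)"
  by (intro borel_measurable_continuous_onI) (simp add: linear_continuous_on linear_linear linear_dilate)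

lemma nn_integral_lborel_prod:
  fixes F :: "'a::euclidean_space \<times> 'b::euclidean_space \<Rightarrow> ennreal"
  assumes "F \<in> borel_measurable borel"
  shows "(\<integral>\<^sup>+x. F x \<partial>lborel) = (\<integral>\<^sup>+x1. \<integral>\<^sup>+x2. F (x1, x2) \<partial>lborel \<partial>lborel)"
  using assms lborel.nn_integral_fst[of F lborel] by (simp add: lborel_prod)

lemma nn_integral_dilate:
  fixes F :: "'a::euclidean_space \<times> 'b::euclidean_space \<Rightarrow> ennreal"
  assumes [measurable]: "F \<in> borel_measurable borel" and "k \<noteq> 0" "l \<noteq> 0"
  shows "(\<integral>\<^sup>+x. F x \<partial>lborel)
    = ennreal (\<bar>k\<bar> ^ DIM('a) * \<bar>l\<bar> ^ DIM('b)) * (\<integral>\<^sup>+u. F (z + dilate k l u) \<partial>lborel)"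
proof -
  have aff: "(\<integral>\<^sup>+x. f x \<partial>lborel) = ennreal (\<bar>c\<bar> ^ DIM('c)) * (\<integral>\<^sup>+x. f (t + c *\<^sub>R x) \<partial>lborel)"
    if [measurable]: "f \<in> borel_measurable borel" and "c \<noteq> 0" for f :: "'c::euclidean_space \<Rightarrow> ennreal" and c t
    using that(2) by (subst lborel_affine[of c t]) (simp_all add: nn_integral_density nn_integral_distr nn_integral_cmult)
  have "(\<integral>\<^sup>+x. F x \<partial>lborel) = (\<integral>\<^sup>+x1. \<integral>\<^sup>+x2. F (x1, x2) \<partial>lborel \<partial>lborel)"
    by (rule nn_integral_lborel_prod) measurable
  also have "\<dots> = (\<integral>\<^sup>+x1. ennreal (\<bar>l\<bar> ^ DIM('b)) * (\<integral>\<^sup>+x2. F (x1, snd z + l *\<^sub>R x2) \<partial>lborel) \<partial>lborel)"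
    using assms by (intro nn_integral_cong aff) auto
  also have "\<dots> = ennreal (\<bar>k\<bar> ^ DIM('a)) * (\<integral>\<^sup>+x1. ennreal (\<bar>l\<bar> ^ DIM('b)) * (\<integral>\<^sup>+x2. F (fst z + k *\<^sub>R x1, snd z + l *\<^sub>R x2) \<partial>lborel) \<partial>lborel)"
    using assms by (intro aff) measurable
  also have "\<dots> = ennreal (\<bar>k\<bar> ^ DIM('a) * \<bar>l\<bar> ^ DIM('b)) * (\<integral>\<^sup>+x1. \<integral>\<^sup>+x2. F (fst z + k *\<^sub>R x1, snd z + l *\<^sub>R x2) \<partial>lborel \<partial>lborel)"
    by (subst nn_integral_cmult) (auto simp: ennreal_mult mult.assoc)
  also have "(\<integral>\<^sup>+x1. \<integral>\<^sup>+x2. F (fst z + k *\<^sub>R x1, snd z + l *\<^sub>R x2) \<partial>lborel \<partial>lborel) = (\<integral>\<^sup>+u. F (z + dilate k l u) \<partial>lborel)"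
    by (subst nn_integral_lborel_prod[of "\<lambda>u. F (z + dilate k l u)"])
      (simp_all add: measurable_compose[OF _ assms(1)] borel_measurable_add, simp add: dilate_def plus_prod_def)
  finally show ?thesis .
qed

definition cube_prod :: "real \<Rightarrow> ((real ^ 'm) \<times> (real ^ 'n)) set" where
  "cube_prod c = cbox (vec (- c), vec (- c)) (vec c, vec c)"

lemma cube_prod_borel [measurable]: "cube_prod c \<in> sets borel"
  by (simp add: cube_prod_def)

lemma mem_cube_prod: "y \<in> cube_prod c \<longleftrightarrow> (\<forall>i. \<bar>fst y $ i\<bar> \<le> c) \<and> (\<forall>i. \<bar>snd y $ i\<bar> \<le> c)"
  by (cases y) (auto simp: cube_prod_def cbox_Pair_eq mem_box_cart abs_le_iff minus_le_iff)

lemma emeasure_lborel_open_pos: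
  assumes "open S" "S \<noteq> {}" shows "emeasure lborel S \<noteq> 0"
  using open_not_negligible[OF assms] assms(1)
  by (auto simp: negligible_iff_null_sets null_sets_completion_iff)

lemma open_sum_ball: "open (sum_ball x r)"
  unfolding sum_ball_def by (intro open_Collect_less continuous_intros)

lemma sum_ball_subset_cube_prod: "sum_ball 0 r \<subseteq> cube_prod r"
proof
  fix y :: "(real ^ 'a) \<times> (real ^ 'b)"
  assume y: "y \<in> sum_ball 0 r"
  have "\<bar>fst y $ i\<bar> \<le> norm (fst y)" "\<bar>snd y $ j\<bar> \<le> norm (snd y)" for i j
    by (rule component_le_norm_cart)+
  moreover have "norm (fst y) + norm (snd y) < r"
    using y by (simp add: sum_ball_def)
  then have "norm (fst y) \<le> r" "norm (snd y) \<le> r"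
    using norm_ge_zero[of "fst y"] norm_ge_zero[of "snd y"] by linarith+
  ultimately show "y \<in> cube_prod r"
    unfolding mem_cube_prod by (meson order_trans)
qed

lemma emeasure_sum_ball:
  fixes r :: real
  defines "B \<equiv> sum_ball 0 r :: ((real ^ 'm) \<times> (real ^ 'n)) set"
  shows "emeasure lborel B < top" "r > 0 \<Longrightarrow> emeasure lborel B \<noteq> 0"
proof -
  have "bounded B"
    using sum_ball_subset_cube_prod unfolding B_def cube_prod_def by (rule bounded_subset[OF bounded_cbox])
  then show "emeasure lborel B < top"
    using emeasure_bounded_finite by simp
  assume "r > 0"
  then have "0 \<in> B" by (simp add: B_def sum_ball_def)
  then show "emeasure lborel B \<noteq> 0"
    unfolding B_def by (intro emeasure_lborel_open_pos open_sum_ball) auto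
qed

lemma emeasure_cube_prod:
  fixes c :: real
  defines "B \<equiv> cube_prod c :: ((real ^ 'm) \<times> (real ^ 'n)) set"
  shows "emeasure lborel B < top" "c > 0 \<Longrightarrow> emeasure lborel B \<noteq> 0"
proof -
  show "emeasure lborel B < top"
    using emeasure_bounded_finite[OF bounded_cbox] by (simp add: B_def cube_prod_def)
  have "emeasure lborel (sum_ball 0 c :: ((real ^ 'm) \<times> (real ^ 'n)) set) \<le> emeasure lborel B"
    unfolding B_def by (intro emeasure_mono sum_ball_subset_cube_prod) simp
  then show "c > 0 \<Longrightarrow> emeasure lborel B \<noteq> 0"
    using emeasure_sum_ball(2)[where 'm='m and 'n='n] by auto
qed

lemma ex_rectangle_dilate:
  fixes z :: "(real ^ 'm) \<times> (real ^ 'n)"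
  assumes k: "k > 0" and l: "l > 0" and c: "c > 0"
  obtains R where "R \<in> rectangles" "\<And>u. z + dilate k l u \<in> R \<longleftrightarrow> u \<in> cube_prod c"
proof -
  let ?I1 = "cbox (fst z - vec (k * c)) (\<chi> i. (fst z - vec (k * c)) $ i + 2 * k * c)"
  let ?I2 = "cbox (snd z - vec (l * c)) (\<chi> i. (snd z - vec (l * c)) $ i + 2 * l * c)"
  have "?I1 \<in> cubes" "?I2 \<in> cubes"
    unfolding cubes_def mem_Collect_eq
    by (intro exI conjI, rule refl, use assms in simp)+
  then have "?I1 \<times> ?I2 \<in> rectangles" by (auto simp: rectangles_def)
  moreover have *: "a - s * c \<le> a + s * t \<and> a + s * t \<le> a - s * c + 2 * s * c \<longleftrightarrow> \<bar>t\<bar> \<le> c"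
    if "s > 0" for a s t :: real
  proof -
    have "a - s * c \<le> a + s * t \<longleftrightarrow> s * (- c) \<le> s * t" by simp
    moreover have "a + s * t \<le> a - s * c + 2 * s * c \<longleftrightarrow> s * t \<le> s * c" by (simp add: mult.commute)
    ultimately show ?thesis using that by (simp only: mult_le_cancel_left_pos) auto
  qed
  have "z + dilate k l u \<in> ?I1 \<times> ?I2 \<longleftrightarrow> u \<in> cube_prod c" for u
    using *[OF k] *[OF l]
    by (cases z; cases u) (simp add: mem_cube_prod dilate_def mem_box_cart all_conj_distrib[symmetric])
  ultimately show ?thesis using that by blast
qed

lemma eaverage_rectangle:
  fixes F :: "(real ^ 'm) \<times> (real ^ 'n) \<Rightarrow> ennreal"
  assumes [measurable]: "F \<in> borel_measurable borel" and k: "k > 0" and l: "l > 0"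
    and R: "R \<in> sets borel" "\<And>u. z + dilate k l u \<in> R \<longleftrightarrow> u \<in> B"
    and [measurable]: "B \<in> sets borel"
  shows "eaverage R F = (\<integral>\<^sup>+u. F (z + dilate k l u) * indicator B u \<partial>lborel) / emeasure lborel B"
proof -
  note [measurable] = R(1)
  define J where "J = \<bar>k\<bar> ^ DIM(real ^ 'm) * \<bar>l\<bar> ^ DIM(real ^ 'n)"
  have J: "J > 0" using k l by (simp add: J_def)
  have ind: "indicator R (z + dilate k l u) = (indicator B u :: ennreal)" for u
    using R(2) by (auto split: split_indicator)
  have "(\<integral>\<^sup>+y. F y * indicator R y \<partial>lborel) = ennreal J * (\<integral>\<^sup>+u. F (z + dilate k l u) * indicator B u \<partial>lborel)"
    unfolding J_def using k l by (subst nn_integral_dilate[of _ k l z]) (simp_all add: ind)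
  moreover have "(\<integral>\<^sup>+y. indicator R y \<partial>lborel) = ennreal J * (\<integral>\<^sup>+u. indicator B u \<partial>lborel)"
    unfolding J_def using k l by (subst nn_integral_dilate[of _ k l z]) (simp_all add: ind)
  moreover have "ennreal J * a / (ennreal J * b) = a / b" for a b
    
    using J divide_mult_eq[of "ennreal J" a b] by (simp add: mult.commute)
  ultimately show ?thesis
    using R(1) unfolding eaverage_def nn_integral_completion
    by (simp add: main_part_sets)
qed

lemma rectangles_borel: "R \<in> rectangles \<Longrightarrow> R \<in> sets borel"
  by (auto simp: rectangles_def cubes_def intro!: borel_Times)

lemma eaverage_cong_AE:
  assumes "AE x in lebesgue. F x = G x"
  shows "eaverage R F = eaverage R G"
proof -
  have "(\<integral>\<^sup>+y\<in>R. F y \<partial>lebesgue) = (\<integral>\<^sup>+y\<in>R. G y \<partial>lebesgue)"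
    using assms by (intro nn_integral_cong_AE) auto
  then show ?thesis by (simp add: eaverage_def)
qed

text \<open>
  Tonelli's theorem is applied to products of Lebesgue measure on the Borel sets, and the pointwise
  inequalities need a finite positive weight; both are achieved by a modification on a null set.
\<close>

lemma weight_borel_representative:
  assumes "weight w"
  obtains v :: "'a::euclidean_space \<Rightarrow> real"
  where "v \<in> borel_measurable borel" "\<And>x. v x > 0" "AE x in lebesgue. w x = ennreal (v x)"
proof -
  have w: "w \<in> borel_measurable lebesgue" "AE x in lebesgue. 0 < w x \<and> w x < top"
    using assms by (auto simp: weight_def)
  obtain u where [measurable]: "u \<in> borel_measurable lborel" and u: "AE x in lborel. w x = u x"
    using completion_ex_borel_measurable[OF w(1)] by blast
  define v where "v x = (if 0 < u x \<and> u x < top then enn2real (u x) else 1)" for x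
  show ?thesis
  proof (rule that[of v])
    show "v \<in> borel_measurable borel" unfolding v_def[abs_def] by measurable
    show "v x > 0" for x by (auto simp: v_def enn2real_positive_iff)
    show "AE x in lebesgue. w x = ennreal (v x)"
      using AE_completion[OF u] w(2) by eventually_elim (auto simp: v_def less_top)
  qed
qed

section \<open>Product A_q weights on dilated boxes\<close>

text \<open>
  The \<open>A_q\<close> condition in the form in which \<open>single_scale_bound\<close> consumes it: as integrals over one fixed
  product of cubes, transported by translations and dilations.  The half side \<open>2\<close> is that of the set of
  differences of points of \<open>cube_prod 1\<close>, over which averages are taken.
\<close>

locale box_weight =
  fixes v :: "(real ^ 'm) \<times> (real ^ 'n) \<Rightarrow> real" and q :: real and C :: ennreal
  assumes q: "q > 1"
    and v [measurable]: "v \<in> borel_measurable borel" and v_pos: "\<And>x. v x > 0" and C: "C < top"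
    and V_fin: "\<And>k l z. k > 0 \<Longrightarrow> l > 0 \<Longrightarrow>
        (\<integral>\<^sup>+u. ennreal (v (z + dilate k l u)) * indicator (cube_prod 2) u \<partial>lborel) < top"
    and S_fin: "\<And>k l z. k > 0 \<Longrightarrow> l > 0 \<Longrightarrow>
        (\<integral>\<^sup>+u. ennreal (v (z + dilate k l u) powr (1 - q / (q - 1))) * indicator (cube_prod 2) u \<partial>lborel) < top"
    and C_bound: "\<And>k l z. k > 0 \<Longrightarrow> l > 0 \<Longrightarrow>
        (\<integral>\<^sup>+u. ennreal (v (z + dilate k l u)) * indicator (cube_prod 2) u \<partial>lborel)
      * epowr (\<integral>\<^sup>+u. ennreal (v (z + dilate k l u) powr (1 - q / (q - 1))) * indicator (cube_prod 2) u \<partial>lborel) (q - 1) \<le> C"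

text \<open>
  The change of variables cancels in the two averages, so the constants differ only by powers of the
  volume of the fixed box.  Both integrals are finite because each of them is positive and their
  product is bounded.
\<close>

lemma product_Ap_imp_box_weight:
  fixes w :: "(real ^ 'm) \<times> (real ^ 'n) \<Rightarrow> ennreal"
  assumes q: "q > 1" and w: "w \<in> product_Ap q"
  obtains v C where "box_weight v q C" "AE x in lebesgue. w x = ennreal (v x)"
proof -
  let ?B = "cube_prod 2 :: ((real ^ 'm) \<times> (real ^ 'n)) set"
  define A where "A = (SUP R\<in>rectangles. eaverage R w * epowr (eaverage R (\<lambda>x. epowr (w x) (1 - q / (q - 1)))) (q - 1))"
  have "weight w" and A: "A < top" using w by (auto simp: product_Ap_def A_def)
  from \<open>weight w\<close> obtain v where [measurable]: "v \<in> borel_measurable borel"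
    and v_pos: "\<And>x. v x > 0" and wv: "AE x in lebesgue. w x = ennreal (v x)"
    using weight_borel_representative by blast
  define \<sigma> where "\<sigma> x = v x powr (1 - q / (q - 1))" for x
  have [measurable]: "\<sigma> \<in> borel_measurable borel" unfolding \<sigma>_def[abs_def] by measurable
  have \<sigma>_pos: "\<sigma> x > 0" for x using v_pos by (simp add: \<sigma>_def less_imp_neq[symmetric])
  define V S where "V k l z = (\<integral>\<^sup>+u. ennreal (v (z + dilate k l u)) * indicator ?B u \<partial>lborel)"
    and "S k l z = (\<integral>\<^sup>+u. ennreal (\<sigma> (z + dilate k l u)) * indicator ?B u \<partial>lborel)" for k l z
  define b where "b = emeasure lborel ?B"
  have b: "b \<noteq> 0" "b < top" using emeasure_cube_prod[of 2] by (auto simp: b_def)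
  have nz: "(\<integral>\<^sup>+u. ennreal (f u) * indicator ?B u \<partial>lborel) \<noteq> 0"
    if [measurable]: "f \<in> borel_measurable borel" and pos: "\<And>u. f u > 0" for f :: "(real ^ 'm) \<times> (real ^ 'n) \<Rightarrow> real"
  proof
    have pos': "ennreal (f u) \<noteq> 0" for u
      using pos[of u] by (simp add: ennreal_eq_0_iff)
    assume "(\<integral>\<^sup>+u. ennreal (f u) * indicator ?B u \<partial>lborel) = 0"
    then have "AE u in lborel. u \<notin> ?B"
      using pos' by (subst (asm) nn_integral_0_iff_AE) (auto split: split_indicator_asm)
    then have "b = 0"
      unfolding b_def by (subst (asm) AE_iff_measurable[of "?B"]) auto
    then show False using b by simp
  qed
  have key: "(V k l z / b) * epowr (S k l z / b) (q - 1) \<le> A" if k: "k > 0" and l: "l > 0" for k l z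
  proof -
    obtain R where R: "R \<in> rectangles" "\<And>u. z + dilate k l u \<in> R \<longleftrightarrow> u \<in> ?B"
      using ex_rectangle_dilate[OF k l zero_less_numeral] by blast
    note av = eaverage_rectangle[OF _ k l rectangles_borel[OF R(1)] R(2) cube_prod_borel]
    have "eaverage R w = V k l z / b"
      using eaverage_cong_AE[OF wv] by (simp add: av V_def b_def)
    moreover have "AE x in lebesgue. epowr (w x) (1 - q / (q - 1)) = ennreal (\<sigma> x)"
      using wv by eventually_elim (simp add: \<sigma>_def epowr_ennreal_pos v_pos)
    from eaverage_cong_AE[OF this] have "eaverage R (\<lambda>x. epowr (w x) (1 - q / (q - 1))) = S k l z / b"
      by (simp add: av S_def b_def)
    ultimately show ?thesis
      unfolding A_def using R(1) by (auto intro: SUP_upper2)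
  qed
  have V0: "V k l z \<noteq> 0" and S0: "S k l z \<noteq> 0" for k l z
    unfolding V_def S_def by (rule nz; simp add: v_pos \<sigma>_pos)+
  have le: "V k l z * epowr (S k l z) (q - 1) \<le> A * b * epowr b (q - 1)" if "k > 0" "l > 0" for k l z
  proof -
    have "x / b * b = x" for x
      using b by (simp add: ennreal_divide_times)
    then have "V k l z * epowr (S k l z) (q - 1) = (V k l z / b * b) * epowr (S k l z / b * b) (q - 1)"
      by simp
    also have "\<dots> = (V k l z / b) * epowr (S k l z / b) (q - 1) * b * epowr b (q - 1)"
      using q by (simp only: epowr_mult) (simp add: epowr_mult mult_ac)
    also have "\<dots> \<le> A * b * epowr b (q - 1)"
      by (intro mult_right_mono key that) auto
    finally show ?thesis .
  qed
  have "b = ennreal (enn2real b)" using b by (simp add: less_top)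
  then have "epowr b (q - 1) < top" using q by (metis epowr_ennreal enn2real_nonneg ennreal_less_top diff_gt_0_iff_gt)
  then have C: "A * b * epowr b (q - 1) < top"
    using A b by (simp add: ennreal_mult_less_top)
  have fin: "V k l z < top" "S k l z < top" if "k > 0" "l > 0" for k l z
  proof -
    have *: "V k l z * epowr (S k l z) (q - 1) < top"
      using le[OF that] C by (rule le_less_trans)
    have "epowr (S k l z) (q - 1) \<noteq> 0"
      using S0 by (cases "S k l z") (use q S0[of k l z] in \<open>auto simp: epowr_ennreal ennreal_eq_0_iff\<close>)
    then have "V k l z < top" "epowr (S k l z) (q - 1) \<noteq> top"
      using * V0[of k l z] by (auto simp: ennreal_mult_less_top)
    then show "V k l z < top" "S k l z < top"
      using q by (cases "S k l z = top"; simp add: less_top)+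
  qed
  have "box_weight v q (A * b * epowr b (q - 1))"
    by unfold_locales (use q v_pos C fin le in \<open>auto simp: V_def S_def \<sigma>_def\<close>)
  then show ?thesis using wv by (rule that)
qed

section \<open>Weighted power integrals\<close>

text \<open>
  The \<open>p\<close>-th power of the norm in \<open>L^p(v)\<close>.  It satisfies \<open>power_integral_split\<close> for every \<open>p > 0\<close>,
  whereas for \<open>p < 1\<close> the norm itself is only a quasi-norm.
\<close>

definition power_integral :: "real \<Rightarrow> ('a::euclidean_space \<Rightarrow> real) \<Rightarrow> ('a \<Rightarrow> complex) \<Rightarrow> ennreal" where
  "power_integral p v f = (\<integral>\<^sup>+x. ennreal (norm (f x) powr p * v x) \<partial>lebesgue)"

definition Cc :: "('a::real_normed_vector \<Rightarrow> complex) set" where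
  "Cc = {h. continuous_on UNIV h \<and> bounded {x. h x \<noteq> 0}}"

lemma borel_imp_lebesgue: "f \<in> borel_measurable borel \<Longrightarrow> f \<in> borel_measurable lebesgue"
  by (rule measurable_completion) simp

lemma Cc_borel: "h \<in> Cc \<Longrightarrow> h \<in> borel_measurable borel"
  by (auto simp: Cc_def intro: borel_measurable_continuous_onI)

lemma Cc_lebesgue: "h \<in> Cc \<Longrightarrow> h \<in> borel_measurable lebesgue"
  by (intro borel_imp_lebesgue Cc_borel)

lemma Cc_diff: "g \<in> Cc \<Longrightarrow> h \<in> Cc \<Longrightarrow> (\<lambda>x. g x - h x) \<in> Cc"
proof -
  assume "g \<in> Cc" "h \<in> Cc"
  moreover have "{x. g x - h x \<noteq> 0} \<subseteq> {x. g x \<noteq> 0} \<union> {x. h x \<noteq> 0}" by auto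
  ultimately show ?thesis
    unfolding Cc_def mem_Collect_eq
    by (blast intro: continuous_on_diff bounded_subset[OF bounded_Un[THEN iffD2]])
qed

lemma power_integral_commute: "power_integral p v (\<lambda>x. f x - g x) = power_integral p v (\<lambda>x. g x - f x)"
  by (simp add: power_integral_def norm_minus_commute)

lemma power_integral_split:
  assumes "p > 0" "\<eta> > 0" and v: "v \<in> borel_measurable borel" "\<And>x. v x > 0"
    and f: "f \<in> borel_measurable lebesgue" and g: "g \<in> borel_measurable lebesgue"
  shows "power_integral p v (\<lambda>x. f x + g x)
    \<le> ennreal ((1 + \<eta>) powr p) * power_integral p v f + ennreal ((1 + 1 / \<eta>) powr p) * power_integral p v g"
proof -
  note [measurable] = f g borel_imp_lebesgue[OF v(1)]
  have "power_integral p v (\<lambda>x. f x + g x) \<le> (\<integral>\<^sup>+x. ennreal ((1 + \<eta>) powr p) * ennreal (norm (f x) powr p * v x)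
      + ennreal ((1 + 1 / \<eta>) powr p) * ennreal (norm (g x) powr p * v x) \<partial>lebesgue)"
    unfolding power_integral_def
  proof (rule nn_integral_mono)
    fix x
    have "norm (f x + g x) powr p \<le> (norm (f x) + norm (g x)) powr p"
      using assms(1) by (intro powr_mono2 norm_triangle_ineq) auto
    also have "\<dots> \<le> (1 + \<eta>) powr p * norm (f x) powr p + (1 + 1 / \<eta>) powr p * norm (g x) powr p"
      using assms by (intro powr_add_le_split) auto
    finally have "norm (f x + g x) powr p * v x
        \<le> ((1 + \<eta>) powr p * norm (f x) powr p + (1 + 1 / \<eta>) powr p * norm (g x) powr p) * v x"
      using v(2)[of x] by (intro mult_right_mono) auto
    also have "\<dots> = (1 + \<eta>) powr p * (norm (f x) powr p * v x) + (1 + 1 / \<eta>) powr p * (norm (g x) powr p * v x)"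
      by (simp add: algebra_simps)
    finally show "ennreal (norm (f x + g x) powr p * v x) \<le> ennreal ((1 + \<eta>) powr p) * ennreal (norm (f x) powr p * v x)
      + ennreal ((1 + 1 / \<eta>) powr p) * ennreal (norm (g x) powr p * v x)"
      using v(2)[of x] by (simp add: ennreal_leI less_imp_le flip: ennreal_plus ennreal_mult)
  qed
  also have "\<dots> = ennreal ((1 + \<eta>) powr p) * power_integral p v f + ennreal ((1 + 1 / \<eta>) powr p) * power_integral p v g"
    unfolding power_integral_def by (simp add: nn_integral_cmult nn_integral_add)
  finally show ?thesis .
qed

lemma power_integral_add_le:
  assumes "p > 0" "v \<in> borel_measurable borel" "\<And>x. v x > 0"
    "f \<in> borel_measurable lebesgue" "g \<in> borel_measurable lebesgue"
  shows "power_integral p v (\<lambda>x. f x + g x) \<le> ennreal (2 powr p) * (power_integral p v f + power_integral p v g)"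
  using power_integral_split[of p 1 v f g] assms by (simp add: distrib_left)

section \<open>Uniform bounds for mixed differences\<close>

lemma epowr_add4_le:
  assumes "s > 0"
  shows "epowr (x1 + x2 + x3 + x4) s
    \<le> ennreal (4 powr s) * (epowr x1 s + epowr x2 s + epowr x3 s + epowr x4 s)"
proof -
  have "epowr ((x1 + x2) + (x3 + x4)) s \<le> ennreal (2 powr s) * (epowr (x1 + x2) s + epowr (x3 + x4) s)"
    by (rule epowr_add_le[OF assms])
  also have "\<dots> \<le> ennreal (2 powr s) * (ennreal (2 powr s) * (epowr x1 s + epowr x2 s)
      + ennreal (2 powr s) * (epowr x3 s + epowr x4 s))"
    using assms by (intro mult_left_mono add_mono epowr_add_le) auto
  also have "\<dots> = ennreal (2 powr s * 2 powr s) * (epowr x1 s + epowr x2 s + epowr x3 s + epowr x4 s)"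
    by (simp add: ennreal_mult algebra_simps)
  also have "2 powr s * 2 powr s = 4 powr s"
    by (simp flip: powr_mult)
  finally show ?thesis by (simp add: add.assoc)
qed

lemma eaverage_lborel:
  assumes "E \<in> sets borel"
  shows "eaverage E F = (\<integral>\<^sup>+y. F y * indicator E y \<partial>lborel) / emeasure lborel E"
  using assms by (simp add: eaverage_def nn_integral_completion main_part_sets)

lemma eaverage_mono:
  "(\<And>y. y \<in> E \<Longrightarrow> F y \<le> G y) \<Longrightarrow> eaverage E F \<le> eaverage E G"
  unfolding eaverage_def
  by (intro divide_right_mono_ennreal nn_integral_mono) (auto split: split_indicator)

text \<open>
  Used to raise the inner exponent \<open>a\<close> to the largest admissible value.
\<close>

lemma eaverage_power_mean:
  fixes F :: "'a::euclidean_space \<Rightarrow> real"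
  assumes "\<kappa> \<ge> 1" and [measurable]: "F \<in> borel_measurable borel" "E \<in> sets borel"
    and "\<And>x. F x \<ge> 0" and "emeasure lborel E \<noteq> 0" "emeasure lborel E < top"
  shows "epowr (eaverage E (\<lambda>y. ennreal (F y))) \<kappa> \<le> eaverage E (\<lambda>y. ennreal (F y powr \<kappa>))"
proof -
  have *: "(\<integral>\<^sup>+y. ennreal (h y) * indicator E y \<partial>lborel) = (\<integral>\<^sup>+y. h y \<partial>(restrict_space lborel E))" for h
    by (simp add: nn_integral_restrict_space)
  have m: "emeasure (restrict_space lborel E) (space (restrict_space lborel E)) = emeasure lborel E"
    by (simp add: emeasure_restrict_space)
  obtain m where "emeasure lborel E = ennreal m" "m > 0"
    using assms(5,6) by (cases "emeasure lborel E") (auto simp: less_le)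
  then show ?thesis
    using power_mean[of \<kappa> F "restrict_space lborel E" m] assms(1,4)
    unfolding eaverage_lborel[OF assms(3)] * m by (simp add: measurable_restrict_space1)
qed

lemma mixed_diff_dilate:
  "mixed_diff (dilate r r y) f x
   = f (x - dilate r r y) - f (x - dilate r 0 y) - f (x - dilate 0 r y) + f (x - dilate 0 0 y)"
  by (cases x) (simp add: mixed_diff_def dilate_def minus_prod_def)

lemma dilate_1_1: "dilate 1 1 y = y" by (simp add: dilate_def)

lemma norm_alternating_sum_powr_le:
  fixes x1 x2 x3 x4 :: "'a::real_normed_vector"
  assumes "b > 0"
  shows "norm (x1 - x2 - x3 + x4) powr b
    \<le> 4 powr b * (norm x1 powr b + norm x2 powr b + norm x3 powr b + norm x4 powr b)"
proof -
  have "norm (x1 - x2 - x3 + x4) \<le> norm x1 + norm x2 + norm x3 + norm x4"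
    by (meson norm_triangle_ineq norm_triangle_ineq4 order_trans add_mono order_refl)
  then have "ennreal (norm (x1 - x2 - x3 + x4) powr b) \<le> epowr (norm x1 + norm x2 + norm x3 + norm x4) b"
    using assms by (simp add: epowr_ennreal powr_mono2 ennreal_leI flip: ennreal_plus)
  also have "\<dots> \<le> ennreal (4 powr b * (norm x1 powr b + norm x2 powr b + norm x3 powr b + norm x4 powr b))"
    using epowr_add4_le[OF assms, of "norm x1" "norm x2" "norm x3" "norm x4"] assms
    by (simp add: epowr_ennreal ennreal_mult)
  finally show ?thesis by (simp add: ennreal_le_iff)
qed

lemma measurable_mixed_diff:
  fixes h :: "'a::euclidean_space \<times> 'b::euclidean_space \<Rightarrow> complex"
  assumes [measurable]: "h \<in> borel_measurable borel" "f \<in> borel_measurable M" "g \<in> borel_measurable M"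
  shows "(\<lambda>z. mixed_diff (f z) h (g z)) \<in> borel_measurable M"
proof -
  have "mixed_diff (f z) h (g z) = h (g z - dilate 1 1 (f z)) - h (g z - dilate 1 0 (f z)) - h (g z - dilate 0 1 (f z)) + h (g z - dilate 0 0 (f z))" for z
    using mixed_diff_dilate[of 1 "f z" h "g z"] by (simp add: dilate_1_1)
  then show ?thesis by simp
qed

context box_weight begin

lemma box_average_bound_pos:
  fixes g :: "(real ^ 'm) \<times> (real ^ 'n) \<Rightarrow> real"
  assumes k: "k > 0" and l: "l > 0" and "g \<in> borel_measurable borel" "\<And>x. g x \<ge> 0"
  shows "(\<integral>\<^sup>+x. epowr (\<integral>\<^sup>+y. ennreal (g (x - dilate k l y)) * indicator (cube_prod 1) y \<partial>lborel) q * ennreal (v x) \<partial>lborel)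
     \<le> C * (\<integral>\<^sup>+x. ennreal (g x powr q * v x) \<partial>lborel)"
proof (rule single_scale_bound[OF q linear_dilate cube_prod_borel cube_prod_borel _ _ _ v v_pos assms(3,4) S_fin[OF k l] C_bound[OF k l]])
  show "0 \<in> (cube_prod 1 :: ((real ^ 'm) \<times> (real ^ 'n)) set)" by (simp add: mem_cube_prod)
  show "y - y' \<in> cube_prod 2" if "y \<in> cube_prod 1" "y' \<in> cube_prod 1" for y y' :: "(real ^ 'm) \<times> (real ^ 'n)"
  proof -
    have *: "\<bar>a - b\<bar> \<le> 2" if "\<bar>a\<bar> \<le> 1" "\<bar>b\<bar> \<le> 1" for a b :: real
      using that by linarith
    show ?thesis using that unfolding mem_cube_prod by (simp add: *)
  qed
qed (auto simp: emeasure_cube_prod)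

text \<open>
  The degenerate cases \<open>k = 0\<close> and \<open>l = 0\<close> are limits of positive scales.
\<close>

lemma box_average_bound:
  fixes g :: "(real ^ 'm) \<times> (real ^ 'n) \<Rightarrow> real"
  assumes k: "k \<ge> 0" and l: "l \<ge> 0" and g: "continuous_on UNIV g" "\<And>x. g x \<ge> 0"
  shows "(\<integral>\<^sup>+x. epowr (\<integral>\<^sup>+y. ennreal (g (x - dilate k l y)) * indicator (cube_prod 1) y \<partial>lborel) q * ennreal (v x) \<partial>lborel)
     \<le> C * (\<integral>\<^sup>+x. ennreal (g x powr q * v x) \<partial>lborel)"
proof (rule average_bound_limit_map)
  let ?e = "\<lambda>j. inverse (real (Suc j))"
  have e0: "?e \<longlonglongrightarrow> 0" by (rule LIMSEQ_inverse_real_of_nat)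
  show "(\<lambda>j. dilate (k + ?e j) (l + ?e j) y) \<longlonglongrightarrow> dilate k l y" for y :: "(real ^ 'm) \<times> (real ^ 'n)"
  proof -
    have "(\<lambda>j. k + ?e j) \<longlonglongrightarrow> k" "(\<lambda>j. l + ?e j) \<longlonglongrightarrow> l"
      using tendsto_add[OF tendsto_const e0] by simp_all
    then show ?thesis
      unfolding dilate_def by (intro tendsto_Pair tendsto_scaleR tendsto_const)
  qed
  have "?e j > 0" for j by simp
  then have "k + ?e j > 0" "l + ?e j > 0" for j
    using k l by (simp_all add: add_nonneg_pos)
  then show "(\<integral>\<^sup>+x. epowr (\<integral>\<^sup>+y. ennreal (g (x - dilate (k + ?e j) (l + ?e j) y)) * indicator (cube_prod 1) y \<partial>lborel) q * ennreal (v x) \<partial>lborel)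
     \<le> C * (\<integral>\<^sup>+x. ennreal (g x powr q * v x) \<partial>lborel)" for j
    using g by (intro box_average_bound_pos) (auto intro: borel_measurable_continuous_onI)
qed (use q g in auto)

text \<open>
  The ball is covered by a dilated copy of the fixed box.
\<close>

lemma weight_ball_finite: "(\<integral>\<^sup>+x. ennreal (v x) * indicator (ball 0 A) x \<partial>lborel) < top"
proof (cases "A > 0")
  case True
  define J where "J = \<bar>A\<bar> ^ DIM(real ^ 'm) * \<bar>A\<bar> ^ DIM(real ^ 'n)"
  have ind: "indicator (ball 0 A) (dilate A A u) \<le> (indicator (cube_prod 2) u :: ennreal)" for u :: "(real ^ 'm) \<times> (real ^ 'n)"
  proof -
    have "u \<in> cube_prod 2" if "dilate A A u \<in> ball 0 A"
    proof -
      have "dilate A A u = A *\<^sub>R u" by (cases u) (simp add: dilate_def)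
      then have "norm u < 1" using that True by simp
      moreover have "norm (fst u) \<le> norm u" "norm (snd u) \<le> norm u"
        by (metis norm_fst_le prod.collapse, metis norm_snd_le prod.collapse)
      ultimately have "norm (fst u) \<le> 2" "norm (snd u) \<le> 2" by linarith+
      then show ?thesis
        unfolding mem_cube_prod by (meson component_le_norm_cart order_trans)
    qed
    then show ?thesis by (auto split: split_indicator)
  qed
  have "(\<integral>\<^sup>+x. ennreal (v x) * indicator (ball 0 A) x \<partial>lborel)
      = ennreal J * (\<integral>\<^sup>+u. ennreal (v (0 + dilate A A u)) * indicator (ball 0 A) (0 + dilate A A u) \<partial>lborel)"
    unfolding J_def using True measurable_weight_on_ball[OF v] by (intro nn_integral_dilate) auto
  also have "\<dots> \<le> ennreal J * (\<integral>\<^sup>+u. ennreal (v (0 + dilate A A u)) * indicator (cube_prod 2) u \<partial>lborel)"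
    using ind by (intro mult_left_mono nn_integral_mono) auto
  also have "\<dots> < top"
    using V_fin[OF True True, of 0] by (simp add: ennreal_mult_less_top)
  finally show ?thesis .
next
  case False
  then have "ball 0 A = ({} :: ((real ^ 'm) \<times> (real ^ 'n)) set)" by simp
  then show ?thesis by (simp only: \<open>ball 0 A = _\<close>) simp
qed

text \<open>
  With \<open>s = p / a\<close> this is the \<open>p\<close>-th power of the \<open>L^p(v)\<close> norm of the averaged mixed difference.
\<close>

definition mixed_osc :: "real \<Rightarrow> real \<Rightarrow> real \<Rightarrow> ((real ^ 'm) \<times> (real ^ 'n) \<Rightarrow> complex) \<Rightarrow> ennreal" where
  "mixed_osc a s r h = (\<integral>\<^sup>+x. epowr (eaverage (sum_ball 0 r) (\<lambda>y. ennreal (norm (mixed_diff y h x) powr a))) s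
     * ennreal (v x) \<partial>lborel)"

lemma measurable_eaverage_mixed_diff:
  assumes [measurable]: "h \<in> borel_measurable borel"
  shows "(\<lambda>x. eaverage (sum_ball 0 r) (\<lambda>y. ennreal (norm (mixed_diff y h x) powr a))) \<in> borel_measurable borel"
proof -
  have [measurable]: "sum_ball 0 r \<in> sets borel" by (simp add: open_sum_ball)
  have [measurable]: "(\<lambda>z. mixed_diff (snd z) h (fst z)) \<in> borel_measurable (lborel \<Otimes>\<^sub>M lborel)"
    by (rule measurable_mixed_diff) (auto intro: measurable_fst'' measurable_snd'')
  then show ?thesis
    by (subst eaverage_lborel) (auto simp: split_beta' divide_ennreal_def intro!: borel_measurable_times_ennreal lborel.borel_measurable_nn_integral)
qed

text \<open>
  The case \<open>s > q\<close> is reduced to the exponent \<open>q\<close> by the power mean inequality, which turns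
  \<open>|h|^a\<close> into \<open>g = |h|^b\<close> with \<open>b q = a s\<close>.  Rescaling \<open>y\<close> by \<open>r\<close> replaces the ball of radius \<open>r\<close> by
  that of radius one, contained in \<open>cube_prod 1\<close>, and the four terms of the mixed difference become
  the averages of \<open>box_average_bound\<close>.
\<close>

lemma mixed_osc_le_power_integral:
  assumes a: "a > 0" and s: "s \<ge> q"
  obtains K where "K < top" "\<And>r h. r > 0 \<Longrightarrow> h \<in> Cc \<Longrightarrow> mixed_osc a s r h \<le> K * power_integral (a * s) v h"
proof -
  define \<kappa> b where "\<kappa> = s / q" and "b = a * \<kappa>"
  have \<kappa>: "\<kappa> \<ge> 1" "\<kappa> * q = s" and b: "b > 0" "b * q = a * s"
    using a s q by (auto simp: \<kappa>_def b_def)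
  let ?B = "\<lambda>r. sum_ball 0 r :: ((real ^ 'm) \<times> (real ^ 'n)) set"
  have [measurable]: "?B r \<in> sets borel" for r by (simp add: open_sum_ball)
  define c where "c = ennreal (4 powr b) / emeasure lborel (?B 1)"
  define K where "K = epowr c q * (ennreal (4 powr q) * (4 * C))"
  have "c < top"
    using emeasure_sum_ball(2)[of 1, where 'm='m and 'n='n] by (auto simp: c_def less_top[symmetric] ennreal_divide_eq_top_iff)
  then have "epowr c q < top"
    using q by (cases c) (auto simp: epowr_ennreal)
  then have "K < top" using C by (simp add: K_def ennreal_mult_less_top)
  moreover have "mixed_osc a s r h \<le> K * power_integral (a * s) v h" if r: "r > 0" and "h \<in> Cc" for r h
  proof -
    have h: "continuous_on UNIV h" using \<open>h \<in> Cc\<close> by (simp add: Cc_def)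
    have [measurable]: "h \<in> borel_measurable borel" using h by (rule borel_measurable_continuous_onI)
    define g where "g x = norm (h x) powr b" for x
    have g: "continuous_on UNIV g" "\<And>x. g x \<ge> 0"
    proof -
      show "continuous_on UNIV g"
        unfolding g_def[abs_def]
        by (rule continuous_on_powr') (use h b(1) in \<open>auto intro: continuous_on_norm\<close>)
    qed (simp add: g_def)
    have [measurable]: "g \<in> borel_measurable borel" using g(1) by (rule borel_measurable_continuous_onI)
    define M where "M k l x = (\<integral>\<^sup>+y. ennreal (g (x - dilate k l y)) * indicator (cube_prod 1) y \<partial>lborel)" for k l x
    have [measurable]: "M k l \<in> borel_measurable borel" for k l
      unfolding M_def[abs_def] by measurable
    define Z where "Z = power_integral (a * s) v h"
    have M_le: "(\<integral>\<^sup>+x. epowr (M k l x) q * ennreal (v x) \<partial>lborel) \<le> C * Z" if "k \<ge> 0" "l \<ge> 0" for k l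
      using box_average_bound[OF that g] b unfolding M_def Z_def power_integral_def nn_integral_completion by (simp add: g_def powr_powr)
    have pt: "epowr (eaverage (?B r) (\<lambda>y. ennreal (norm (mixed_diff y h x) powr a))) s
        \<le> epowr c q * (ennreal (4 powr q) * (epowr (M r r x) q + epowr (M r 0 x) q + epowr (M 0 r x) q + epowr (M 0 0 x) q))" for x
    proof -
      have [measurable]: "(\<lambda>y. mixed_diff y h x) \<in> borel_measurable borel"
        by (rule measurable_mixed_diff) auto
      have "epowr (eaverage (?B r) (\<lambda>y. ennreal (norm (mixed_diff y h x) powr a))) \<kappa>
          \<le> eaverage (?B r) (\<lambda>y. ennreal ((norm (mixed_diff y h x) powr a) powr \<kappa>))"
        using \<kappa> r emeasure_sum_ball by (intro eaverage_power_mean) auto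
      also have "\<dots> = eaverage (?B r) (\<lambda>y. ennreal (norm (mixed_diff y h x) powr b))"
        by (simp add: powr_powr b_def)
      also have "\<dots> = (\<integral>\<^sup>+u. ennreal (norm (mixed_diff (0 + dilate r r u) h x) powr b) * indicator (?B 1) u \<partial>lborel) / emeasure lborel (?B 1)"
      proof (rule eaverage_rectangle[OF _ r r])
        show "0 + dilate r r u \<in> ?B r \<longleftrightarrow> u \<in> ?B 1" for u
          using r by (simp add: sum_ball_def dilate_def flip: distrib_left)
      qed measurable
      also have "\<dots> \<le> (\<integral>\<^sup>+u. ennreal (4 powr b) * ((ennreal (g (x - dilate r r u)) + ennreal (g (x - dilate r 0 u))
            + ennreal (g (x - dilate 0 r u)) + ennreal (g (x - dilate 0 0 u))) * indicator (cube_prod 1) u) \<partial>lborel) / emeasure lborel (?B 1)"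
      proof (intro divide_right_mono_ennreal nn_integral_mono)
        fix u
        have "ennreal (norm (mixed_diff (dilate r r u) h x) powr b) \<le> ennreal (4 powr b) * (ennreal (g (x - dilate r r u)) + ennreal (g (x - dilate r 0 u))
            + ennreal (g (x - dilate 0 r u)) + ennreal (g (x - dilate 0 0 u)))"
          using norm_alternating_sum_powr_le[OF b(1), of "h (x - dilate r r u)" "h (x - dilate r 0 u)" "h (x - dilate 0 r u)" "h (x - dilate 0 0 u)"]
          by (simp add: mixed_diff_dilate g_def ennreal_leI flip: ennreal_plus ennreal_mult)
        then show "ennreal (norm (mixed_diff (0 + dilate r r u) h x) powr b) * indicator (?B 1) u
          \<le> ennreal (4 powr b) * ((ennreal (g (x - dilate r r u)) + ennreal (g (x - dilate r 0 u))
            + ennreal (g (x - dilate 0 r u)) + ennreal (g (x - dilate 0 0 u))) * indicator (cube_prod 1) u)"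
          using sum_ball_subset_cube_prod[of 1, where 'a='m and 'b='n] by (auto split: split_indicator)
      qed
      also have "\<dots> = c * (M r r x + M r 0 x + M 0 r x + M 0 0 x)"
        unfolding M_def c_def by (subst nn_integral_cmult) (simp_all add: distrib_right nn_integral_add ennreal_times_divide ennreal_divide_times)
      finally have "epowr (eaverage (?B r) (\<lambda>y. ennreal (norm (mixed_diff y h x) powr a))) \<kappa> \<le> c * (M r r x + M r 0 x + M 0 r x + M 0 0 x)" .
      then have "epowr (epowr (eaverage (?B r) (\<lambda>y. ennreal (norm (mixed_diff y h x) powr a))) \<kappa>) q \<le> epowr (c * (M r r x + M r 0 x + M 0 r x + M 0 0 x)) q"
        using q by (intro epowr_mono) auto
      also have "\<dots> \<le> epowr c q * (ennreal (4 powr q) * (epowr (M r r x) q + epowr (M r 0 x) q + epowr (M 0 r x) q + epowr (M 0 0 x) q))"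
        using q by (simp add: epowr_mult mult_left_mono epowr_add4_le)
      finally show ?thesis using \<kappa> q by (simp add: epowr_epowr)
    qed
    have "mixed_osc a s r h \<le> (\<integral>\<^sup>+x. epowr c q * (ennreal (4 powr q) * (epowr (M r r x) q + epowr (M r 0 x) q + epowr (M 0 r x) q + epowr (M 0 0 x) q)) * ennreal (v x) \<partial>lborel)"
      unfolding mixed_osc_def by (intro nn_integral_mono mult_right_mono pt) auto
    also have "\<dots> = (\<integral>\<^sup>+x. epowr c q * (ennreal (4 powr q) * (epowr (M r r x) q * ennreal (v x) + epowr (M r 0 x) q * ennreal (v x)
        + epowr (M 0 r x) q * ennreal (v x) + epowr (M 0 0 x) q * ennreal (v x))) \<partial>lborel)"
      by (intro nn_integral_cong) (simp add: algebra_simps)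
    also have "\<dots> = epowr c q * (ennreal (4 powr q) * ((\<integral>\<^sup>+x. epowr (M r r x) q * ennreal (v x) \<partial>lborel) + (\<integral>\<^sup>+x. epowr (M r 0 x) q * ennreal (v x) \<partial>lborel)
        + (\<integral>\<^sup>+x. epowr (M 0 r x) q * ennreal (v x) \<partial>lborel) + (\<integral>\<^sup>+x. epowr (M 0 0 x) q * ennreal (v x) \<partial>lborel)))"
      using q by (simp add: nn_integral_cmult nn_integral_add)
    also have "\<dots> \<le> epowr c q * (ennreal (4 powr q) * (C * Z + C * Z + C * Z + C * Z))"
      using r by (intro mult_left_mono add_mono M_le) auto
    also have "C * Z + C * Z + C * Z + C * Z = (1 + 1 + 1 + 1) * (C * Z)"
      by (simp only: distrib_right mult_1_left)
    also have "\<dots> = 4 * C * Z" by (simp add: mult.assoc)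
    finally show ?thesis by (simp add: K_def Z_def mult.assoc)
  qed
  ultimately show ?thesis by (rule that)
qed

lemma mixed_osc_add_le:
  assumes a: "a > 0" and s: "s > 0"
  obtains K where "K < top" "\<And>r g h. g \<in> borel_measurable borel \<Longrightarrow> h \<in> borel_measurable borel \<Longrightarrow>
    mixed_osc a s r g \<le> K * (mixed_osc a s r (\<lambda>x. g x - h x) + mixed_osc a s r h)"
proof -
  define K where "K = epowr (ennreal (2 powr a)) s * ennreal (2 powr s)"
  have "K < top" using s by (simp add: K_def epowr_ennreal ennreal_mult_less_top)
  moreover have "mixed_osc a s r g \<le> K * (mixed_osc a s r (\<lambda>x. g x - h x) + mixed_osc a s r h)"
    if [measurable]: "g \<in> borel_measurable borel" "h \<in> borel_measurable borel" for r g h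
  proof -
    define E where "E f x = eaverage (sum_ball 0 r) (\<lambda>y. ennreal (norm (mixed_diff y f x) powr a))" for f :: "(real ^ 'm) \<times> (real ^ 'n) \<Rightarrow> complex" and x
    have [measurable]: "E f \<in> borel_measurable borel" if "f \<in> borel_measurable borel" for f
      unfolding E_def[abs_def] using that by (rule measurable_eaverage_mixed_diff)
    have B: "sum_ball 0 r \<in> sets borel" by (simp add: open_sum_ball)
    have md [measurable]: "(\<lambda>y. mixed_diff y f x) \<in> borel_measurable borel" if "f \<in> borel_measurable borel" for f :: "(real ^ 'm) \<times> (real ^ 'n) \<Rightarrow> complex" and x
      using that by (rule measurable_mixed_diff) auto
    have pt: "epowr (E g x) s \<le> K * (epowr (E (\<lambda>x. g x - h x) x) s + epowr (E h x) s)" for x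
    proof -
      have "E g x \<le> eaverage (sum_ball 0 r) (\<lambda>y. ennreal (2 powr a) * (ennreal (norm (mixed_diff y (\<lambda>x. g x - h x) x) powr a) + ennreal (norm (mixed_diff y h x) powr a)))"
        unfolding E_def
      proof (rule eaverage_mono)
        fix y
        have "mixed_diff y g x = mixed_diff y (\<lambda>x. g x - h x) x + mixed_diff y h x"
          by (simp add: mixed_diff_def)
        then have "norm (mixed_diff y g x) powr a \<le> (norm (mixed_diff y (\<lambda>x. g x - h x) x) + norm (mixed_diff y h x)) powr a"
          using a by (auto intro!: powr_mono2 norm_triangle_ineq)
        also have "\<dots> \<le> 2 powr a * (norm (mixed_diff y (\<lambda>x. g x - h x) x) powr a + norm (mixed_diff y h x) powr a)"
          using powr_add_le_split[of "norm (mixed_diff y (\<lambda>x. g x - h x) x)" "norm (mixed_diff y h x)" a 1] a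
          by (simp add: algebra_simps)
        finally show "ennreal (norm (mixed_diff y g x) powr a) \<le> ennreal (2 powr a) * (ennreal (norm (mixed_diff y (\<lambda>x. g x - h x) x) powr a) + ennreal (norm (mixed_diff y h x) powr a))"
          by (simp add: ennreal_leI flip: ennreal_plus ennreal_mult)
      qed
      also have "\<dots> = ennreal (2 powr a) * (E (\<lambda>x. g x - h x) x + E h x)"
      proof -
        let ?m = "\<lambda>f y. ennreal (norm (mixed_diff y f x) powr a) * indicator (sum_ball 0 r) y"
        note [measurable] = B
        have gh [measurable]: "(\<lambda>x. g x - h x) \<in> borel_measurable borel" by measurable
        have [measurable]: "?m f \<in> borel_measurable borel" if "f \<in> borel_measurable borel" for f
          using md[OF that, of x] by measurable
        have "(\<integral>\<^sup>+y. ennreal (2 powr a) * (?m (\<lambda>x. g x - h x) y + ?m h y) \<partial>lborel)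
            = ennreal (2 powr a) * ((\<integral>\<^sup>+y. ?m (\<lambda>x. g x - h x) y \<partial>lborel) + (\<integral>\<^sup>+y. ?m h y \<partial>lborel))"
          using gh by (simp add: nn_integral_cmult nn_integral_add)
        then show ?thesis
          unfolding E_def eaverage_lborel[OF B]
          by (simp add: mult.assoc distrib_right ennreal_times_divide flip: add_divide_distrib_ennreal)
      qed
      finally have "epowr (E g x) s \<le> epowr (ennreal (2 powr a) * (E (\<lambda>x. g x - h x) x + E h x)) s"
        using s by (rule epowr_mono[rotated])
      also have "\<dots> \<le> epowr (ennreal (2 powr a)) s * (ennreal (2 powr s) * (epowr (E (\<lambda>x. g x - h x) x) s + epowr (E h x) s))"
        using s by (simp add: epowr_mult mult_left_mono epowr_add_le)
      finally show ?thesis by (simp add: K_def mult.assoc)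
    qed
    have "mixed_osc a s r g \<le> (\<integral>\<^sup>+x. K * (epowr (E (\<lambda>x. g x - h x) x) s * ennreal (v x) + epowr (E h x) s * ennreal (v x)) \<partial>lborel)"
      unfolding mixed_osc_def E_def[symmetric]
    proof (rule nn_integral_mono)
      show "epowr (E g x) s * ennreal (v x) \<le> K * (epowr (E (\<lambda>x. g x - h x) x) s * ennreal (v x) + epowr (E h x) s * ennreal (v x))" for x
        using mult_right_mono[OF pt[of x], of "ennreal (v x)"] by (simp add: mult.assoc distrib_right)
    qed
    also have "\<dots> = K * (mixed_osc a s r (\<lambda>x. g x - h x) + mixed_osc a s r h)"
      unfolding mixed_osc_def E_def[symmetric] using s by (simp add: nn_integral_cmult nn_integral_add)
    finally show ?thesis .
  qed
  ultimately show ?thesis by (rule that)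
qed

text \<open>
  The mixed difference is a difference of two increments in the second variable, hence small by
  uniform continuity; and it vanishes for \<open>x\<close> far from the support of \<open>h\<close>, where all four points lie
  outside.  What remains is the finite mass of \<open>v\<close> on a ball.
\<close>

lemma mixed_osc_Cc_small:
  assumes a: "a > 0" and s: "s > 0" and "h \<in> Cc" and e: "e > 0"
  obtains \<delta> where "\<delta> > 0" "\<And>r. 0 < r \<Longrightarrow> r < \<delta> \<Longrightarrow> mixed_osc a s r h \<le> ennreal e"
proof -
  have h: "continuous_on UNIV h" "bounded {x. h x \<noteq> 0}" using \<open>h \<in> Cc\<close> by (auto simp: Cc_def)
  obtain A where A: "A > 0" "\<And>x. h x \<noteq> 0 \<Longrightarrow> norm x \<le> A"
    using h(2) unfolding bounded_pos by auto
  define W where "W = (\<integral>\<^sup>+x. ennreal (v x) * indicator (ball 0 (A + 3)) x \<partial>lborel)"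
  obtain W' where W': "W = ennreal W'" "W' \<ge> 0"
    using weight_ball_finite[of "A + 3"] unfolding W_def[symmetric] by (cases W) auto
  \<comment> \<open>mixed differences of size at most \<open>\<epsilon>\<close> contribute at most \<open>\<epsilon> powr (a * s) * W \<le> e\<close>\<close>
  define \<epsilon> where "\<epsilon> = (e / (W' + 1)) powr (1 / (a * s))"
  have \<epsilon>: "\<epsilon> > 0" using e W' by (simp add: \<epsilon>_def)
  have unif: "uniformly_continuous_on UNIV h"
  proof -
    have "uniformly_continuous_on (cball 0 (A + 1)) h"
      using h(1) by (intro compact_uniformly_continuous) (auto intro: continuous_on_subset)
    then have *: "\<exists>d>0. \<forall>x\<in>cball 0 (A + 1). \<forall>y\<in>cball 0 (A + 1). dist y x < d \<longrightarrow> dist (h y) (h x) < \<eta>" if "\<eta> > 0" for \<eta>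
      using that unfolding uniformly_continuous_on_def by blast
    show ?thesis
      unfolding uniformly_continuous_on_def
    proof (intro allI impI)
      fix \<eta> :: real assume \<eta>: "\<eta> > 0"
      obtain d where d: "d > 0" "\<forall>x\<in>cball 0 (A + 1). \<forall>y\<in>cball 0 (A + 1). dist y x < d \<longrightarrow> dist (h y) (h x) < \<eta>"
        using *[OF \<eta>] by blast
      have "dist (h y) (h x) < \<eta>" if xy: "dist y x < min 1 d" for x y
      proof (cases "norm x \<le> A + 1 \<and> norm y \<le> A + 1")
        case True
        then show ?thesis using d xy by simp
      next
        case False
        have "\<bar>norm y - norm x\<bar> < 1"
          using xy norm_triangle_ineq3[of y x] by (simp add: dist_norm)
        then have "\<not> norm x \<le> A" "\<not> norm y \<le> A" using False by linarith+
        then have "h x = 0" "h y = 0" using A(2) by blast+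
        then show ?thesis using \<eta> by simp
      qed
      then show "\<exists>d>0. \<forall>x\<in>UNIV. \<forall>x'\<in>UNIV. dist x' x < d \<longrightarrow> dist (h x') (h x) < \<eta>"
        using d(1) by (intro exI[of _ "min 1 d"]) auto
    qed
  qed
  then obtain d where d: "d > 0" "\<And>x y. dist x y < d \<Longrightarrow> dist (h x) (h y) < \<epsilon> / 2"
    unfolding uniformly_continuous_on_def using \<epsilon> by (metis UNIV_I half_gt_zero)
  show ?thesis
  proof (rule that[of "min 1 d"])
    fix r assume r: "0 < r" "r < min 1 d"
    let ?B = "sum_ball 0 r :: ((real ^ 'm) \<times> (real ^ 'n)) set"
    \<comment> \<open>the four points are within distance one of \<open>x\<close>, so the radius \<open>A + 3\<close> leaves ample room\<close>
    have md: "norm (mixed_diff y h x) powr a \<le> \<epsilon> powr a * indicator (ball 0 (A + 3)) x" if y: "y \<in> ?B" for x y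
    proof -
      have ny: "norm (fst y) + norm (snd y) < r" using y by (simp add: sum_ball_def)
      have sh: "norm (x - dilate k l y) \<ge> norm x - 1" if "k \<in> {0,1}" "l \<in> {0,1}" for k l
      proof -
        have "norm (dilate k l y) \<le> norm (k *\<^sub>R fst y) + norm (l *\<^sub>R snd y)"
          unfolding dilate_def using norm_Pair_le by blast
        also have "\<dots> \<le> norm (fst y) + norm (snd y)" using that by auto
        finally show ?thesis using norm_triangle_ineq2[of x "dilate k l y"] ny r by simp
      qed
      have eq: "mixed_diff y h x = h (x - dilate 1 1 y) - h (x - dilate 1 0 y) - h (x - dilate 0 1 y) + h (x - dilate 0 0 y)"
        using mixed_diff_dilate[of 1 y h x] by (simp add: dilate_1_1)
      show ?thesis
      proof (cases "norm x < A + 3")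
        case True
        have "dist (x - dilate 1 1 y) (x - dilate 1 0 y) = norm (snd y)" "dist (x - dilate 0 1 y) (x - dilate 0 0 y) = norm (snd y)"
          by (cases x; cases y; simp add: dist_norm dilate_def norm_Pair norm_minus_commute)+
        moreover have "norm (snd y) < d" using ny r norm_ge_zero[of "fst y"] by linarith
        ultimately have "norm (h (x - dilate 1 1 y) - h (x - dilate 1 0 y)) < \<epsilon> / 2" "norm (h (x - dilate 0 1 y) - h (x - dilate 0 0 y)) < \<epsilon> / 2"
          using d(2) by (metis dist_norm)+
        moreover have "norm (mixed_diff y h x) \<le> norm (h (x - dilate 1 1 y) - h (x - dilate 1 0 y)) + norm (h (x - dilate 0 1 y) - h (x - dilate 0 0 y))"
          unfolding eq by (metis (no_types, lifting) diff_diff_eq2 diff_add_eq norm_triangle_ineq4)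
        ultimately have "norm (mixed_diff y h x) \<le> \<epsilon>" by linarith
        then show ?thesis using True a by (simp add: powr_mono2)
      next
        case False
        have "h (x - dilate k l y) = 0" if "k \<in> {0,1}" "l \<in> {0,1}" for k l
          using sh[OF that] False A(2)[of "x - dilate k l y"] by force
        then show ?thesis unfolding eq using False a by simp
      qed
    qed
    have "mixed_osc a s r h \<le> (\<integral>\<^sup>+x. ennreal (\<epsilon> powr (a * s)) * (ennreal (v x) * indicator (ball 0 (A + 3)) x) \<partial>lborel)"
      unfolding mixed_osc_def
    proof (rule nn_integral_mono)
      fix x
      have "eaverage ?B (\<lambda>y. ennreal (norm (mixed_diff y h x) powr a)) \<le> eaverage ?B (\<lambda>y. ennreal (\<epsilon> powr a * indicator (ball 0 (A + 3)) x))"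
        using md by (intro eaverage_mono ennreal_leI)
      also have "\<dots> = ennreal (\<epsilon> powr a * indicator (ball 0 (A + 3)) x)"
        using emeasure_sum_ball[of r, where 'm='m and 'n='n] r
        by (subst eaverage_lborel) (auto simp: open_sum_ball nn_integral_cmult_indicator ennreal_mult_divide_eq)
      finally have "epowr (eaverage ?B (\<lambda>y. ennreal (norm (mixed_diff y h x) powr a))) s \<le> epowr (ennreal (\<epsilon> powr a * indicator (ball 0 (A + 3)) x)) s"
        using s by (rule epowr_mono[rotated])
      also have "\<dots> = ennreal (\<epsilon> powr (a * s)) * indicator (ball 0 (A + 3)) x"
        using s by (auto simp: epowr_ennreal powr_powr split: split_indicator)
      finally have "epowr (eaverage ?B (\<lambda>y. ennreal (norm (mixed_diff y h x) powr a))) s * ennreal (v x)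
          \<le> ennreal (\<epsilon> powr (a * s)) * indicator (ball 0 (A + 3)) x * ennreal (v x)"
        by (rule mult_right_mono) simp
      then show "epowr (eaverage ?B (\<lambda>y. ennreal (norm (mixed_diff y h x) powr a))) s * ennreal (v x) \<le> ennreal (\<epsilon> powr (a * s)) * (ennreal (v x) * indicator (ball 0 (A + 3)) x)"
        by (simp only: mult_ac)
    qed
    also have "\<dots> = ennreal (\<epsilon> powr (a * s)) * W"
      unfolding W_def using measurable_weight_on_ball[OF v] by (subst nn_integral_cmult) auto
    also have "\<dots> = ennreal (e / (W' + 1) * W')"
      using a s e W' by (simp add: \<epsilon>_def powr_powr flip: ennreal_mult)
    also have "\<dots> \<le> ennreal e"
      using e W' by (intro ennreal_leI) (simp add: field_simps)
    finally show "mixed_osc a s r h \<le> ennreal e" .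
  qed (use d in auto)
qed

end

section \<open>Density of continuous compactly supported functions\<close>

lemma Cc_power_integral_finite:
  assumes p: "p > 0" and v: "v \<in> borel_measurable borel" "\<And>x. v x > 0"
    and loc: "\<And>A. (\<integral>\<^sup>+x. ennreal (v x) * indicator (ball 0 A) x \<partial>lborel) < top"
    and h: "h \<in> Cc"
  shows "power_integral p v (h :: 'a::euclidean_space \<Rightarrow> complex) < top"
proof -
  obtain A where A: "A > 0" "\<And>x. h x \<noteq> 0 \<Longrightarrow> norm x < A"
    using h unfolding Cc_def bounded_pos_less by blast
  have "compact (h ` cball 0 A)"
    using h by (intro compact_continuous_image) (auto simp: Cc_def intro: continuous_on_subset)
  then obtain M where M: "\<And>x. x \<in> cball 0 A \<Longrightarrow> norm (h x) \<le> M"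
    using compact_imp_bounded bounded_iff by (metis image_eqI)
  have "power_integral p v h \<le> (\<integral>\<^sup>+x. ennreal (M powr p) * (ennreal (v x) * indicator (ball 0 A) x) \<partial>lborel)"
    unfolding power_integral_def nn_integral_completion
  proof (rule nn_integral_mono)
    fix x
    show "ennreal (norm (h x) powr p * v x) \<le> ennreal (M powr p) * (ennreal (v x) * indicator (ball 0 A) x)"
    proof (cases "norm x < A")
      case True
      then have "norm (h x) powr p * v x \<le> M powr p * v x"
        using M[of x] p v(2)[of x] by (intro mult_right_mono powr_mono2) auto
      then show ?thesis using True v(2)[of x] by (simp add: ennreal_leI flip: ennreal_mult)
    next
      case False
      then have "h x = 0" using A(2) by blast
      then show ?thesis using p by simp
    qed
  qed
  also have "\<dots> = ennreal (M powr p) * (\<integral>\<^sup>+x. ennreal (v x) * indicator (ball 0 A) x \<partial>lborel)"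
    using measurable_weight_on_ball[OF v(1)] by (subst nn_integral_cmult) auto
  also have "\<dots> < top" using loc by (simp add: ennreal_mult_less_top)
  finally show ?thesis .
qed

lemma tendsto_ennreal_0: "(f \<longlongrightarrow> 0) F \<Longrightarrow> ((\<lambda>x. ennreal (f x)) \<longlongrightarrow> 0) F"
  using tendsto_ennrealI[of f 0 F] by simp

text \<open>
  Dominated convergence.
\<close>

lemma power_integral_tendsto_0:
  fixes v :: "'a::euclidean_space \<Rightarrow> real"
  assumes p: "p > 0" and v: "v \<in> borel_measurable borel" "\<And>x. v x > 0"
    and F: "\<And>n. F n \<in> borel_measurable lebesgue" "f \<in> borel_measurable lebesgue"
    and G: "G \<in> borel_measurable lebesgue" "power_integral p v G < top"
    and dom: "\<And>n. AE x in lebesgue. norm (F n x - f x) \<le> norm (G x)"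
    and lim: "AE x in lebesgue. (\<lambda>n. F n x) \<longlonglongrightarrow> f x"
  shows "(\<lambda>n. power_integral p v (\<lambda>x. F n x - f x)) \<longlonglongrightarrow> 0"
proof -
  note [measurable] = F G(1) borel_imp_lebesgue[OF v(1)]
  have "(\<lambda>n. power_integral p v (\<lambda>x. F n x - f x)) \<longlonglongrightarrow> (\<integral>\<^sup>+x. 0 \<partial>(lebesgue :: 'a measure))"
    unfolding power_integral_def
  proof (rule nn_integral_dominated_convergence)
    show "AE x in lebesgue. ennreal (norm (F n x - f x) powr p * v x) \<le> ennreal (norm (G x) powr p * v x)" for n
      using dom[of n] by eventually_elim
        (use p v(2) in \<open>auto intro!: ennreal_leI mult_right_mono powr_mono2 simp: less_imp_le\<close>)
    show "AE x in lebesgue. (\<lambda>n. ennreal (norm (F n x - f x) powr p * v x)) \<longlonglongrightarrow> 0"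
      using lim
    proof eventually_elim
      fix x assume "(\<lambda>n. F n x) \<longlonglongrightarrow> f x"
      then have "(\<lambda>n. norm (F n x - f x)) \<longlonglongrightarrow> 0"
        by (simp add: tendsto_norm_zero LIM_zero)
      then have "(\<lambda>n. norm (F n x - f x) powr p) \<longlonglongrightarrow> 0"
        using p tendsto_powr'[of "\<lambda>n. norm (F n x - f x)" 0 sequentially "\<lambda>_. p" p] by simp
      from tendsto_mult_right[OF this, of "v x"]
      show "(\<lambda>n. ennreal (norm (F n x - f x) powr p * v x)) \<longlonglongrightarrow> 0"
        by (intro tendsto_ennreal_0) simp
    qed
  qed (use G(2) in \<open>simp_all add: power_integral_def\<close>)
  then show ?thesis by simp
qed

text \<open>
  The radial projection onto the disc of radius \<open>m\<close>, in a form that is visibly continuous.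
\<close>

definition radial_trunc :: "real \<Rightarrow> complex \<Rightarrow> complex" where
  "radial_trunc m z = (m / max m (norm z)) *\<^sub>R z"

definition cutoff :: "real \<Rightarrow> 'a::real_normed_vector \<Rightarrow> real" where
  "cutoff m x = max 0 (min 1 (m + 1 - norm x))"

lemma radial_trunc_props:
  assumes "m > 0"
  shows "norm (radial_trunc m z) \<le> m" "norm (radial_trunc m z) \<le> norm z" "norm z \<le> m \<Longrightarrow> radial_trunc m z = z"
    "continuous_on UNIV (radial_trunc m)"
proof -
  have "norm (radial_trunc m z) = m * norm z / max m (norm z)"
    using assms by (simp add: radial_trunc_def)
  then show "norm (radial_trunc m z) \<le> m" "norm (radial_trunc m z) \<le> norm z"
    using assms by (auto simp: divide_le_eq max_def mult.commute intro: mult_right_mono mult_left_mono)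
  show "norm z \<le> m \<Longrightarrow> radial_trunc m z = z" using assms by (simp add: radial_trunc_def max_def)
  show "continuous_on UNIV (radial_trunc m)"
    unfolding radial_trunc_def[abs_def] using assms
    by (intro continuous_intros) (auto simp: max_def)
qed

lemma cutoff_props: "0 \<le> cutoff m x" "cutoff m x \<le> 1" "norm x \<le> m \<Longrightarrow> cutoff m x = 1"
    "norm x \<ge> m + 1 \<Longrightarrow> cutoff m x = 0" "continuous_on UNIV (cutoff m)"
  unfolding cutoff_def[abs_def] by (auto intro!: continuous_intros)

text \<open>
  Truncating the values of \<open>f\<close> and cutting off near infinity is harmless by dominated convergence.
  The truncated function is a limit almost everywhere of functions in \<open>Cc\<close>, obtained by applying
  the same truncation and cutoff to a sequence of continuous functions that converges to \<open>f\<close> almost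
  everywhere; these are uniformly bounded and supported in one ball, which has finite \<open>v\<close>-mass, so
  dominated convergence applies again.
\<close>

lemma Cc_dense:
  fixes v :: "'a::euclidean_space \<Rightarrow> real"
  assumes p: "p > 0" and v: "v \<in> borel_measurable borel" "\<And>x. v x > 0"
    and loc: "\<And>A. (\<integral>\<^sup>+x. ennreal (v x) * indicator (ball 0 A) x \<partial>lborel) < top"
    and f: "f \<in> borel_measurable lebesgue" "power_integral p v f < top" and e: "e > 0"
  shows "\<exists>h\<in>Cc. power_integral p v (\<lambda>x. h x - f x) \<le> ennreal e"
proof -
  note [measurable] = f(1)
  define \<delta> where "\<delta> = e / (2 * 2 powr p)"
  have \<delta>: "\<delta> > 0" using e by (simp add: \<delta>_def)
  have tr: "continuous_on UNIV (radial_trunc (real (Suc m)))" for m by (rule radial_trunc_props) simp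
  have [measurable]: "radial_trunc (real (Suc m)) \<in> borel_measurable borel" for m
    using tr by (rule borel_measurable_continuous_onI)
  have [measurable]: "cutoff m \<in> borel_measurable (lebesgue :: 'a measure)" for m
    by (intro borel_imp_lebesgue borel_measurable_continuous_onI cutoff_props)
  define F where "F m x = cutoff (real (Suc m)) x *\<^sub>R radial_trunc (real (Suc m)) (f x)" for m x
  have F [measurable]: "F m \<in> borel_measurable lebesgue" for m unfolding F_def by measurable
  have "(\<lambda>m. power_integral p v (\<lambda>x. F m x - f x)) \<longlonglongrightarrow> 0"
  proof (rule power_integral_tendsto_0[OF p v, where G="\<lambda>x. 2 * f x"])
    have "power_integral p v (\<lambda>x. 2 * f x) = power_integral p v (\<lambda>x. f x + f x)" by (simp only: mult_2)
    also have "\<dots> \<le> ennreal (2 powr p) * (power_integral p v f + power_integral p v f)"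
      using p v f by (intro power_integral_add_le)
    also have "\<dots> < top" using f(2) by (simp add: ennreal_mult_less_top)
    finally show "power_integral p v (\<lambda>x. 2 * f x) < top" .
    have "norm (F m x) \<le> norm (f x)" for m x
    proof -
      have "norm (F m x) = cutoff (real (Suc m)) x * norm (radial_trunc (real (Suc m)) (f x))"
        by (simp add: F_def cutoff_props)
      also have "\<dots> \<le> 1 * norm (f x)"
        by (intro mult_mono radial_trunc_props cutoff_props) auto
      finally show ?thesis by simp
    qed
    note F_le = this
    have "norm (F m x - f x) \<le> norm (2 * f x)" for m x
    proof -
      have "norm (F m x - f x) \<le> norm (F m x) + norm (f x)" by (rule norm_triangle_ineq4)
      moreover have "norm (2 * f x) = 2 * norm (f x)" by (simp add: norm_mult)
      ultimately show ?thesis using F_le[of m x] by linarith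
    qed
    then show "AE x in lebesgue. norm (F m x - f x) \<le> norm (2 * f x)" for m
      by simp
    have "(\<lambda>m. F m x) \<longlonglongrightarrow> f x" for x
    proof (rule tendsto_eventually)
      obtain k where k: "norm x + norm (f x) \<le> real k" using real_arch_simple by blast
      show "\<forall>\<^sub>F m in sequentially. F m x = f x"
        using eventually_ge_at_top[of k]
      proof eventually_elim
        fix m assume "k \<le> m"
        then have "norm x + norm (f x) \<le> real (Suc m)" using k by linarith
        then have "norm x \<le> real (Suc m)" "norm (f x) \<le> real (Suc m)"
          using norm_ge_zero[of x] norm_ge_zero[of "f x"] by linarith+
        then show "F m x = f x"
          unfolding F_def by (simp only: cutoff_props(3) radial_trunc_props(3) of_nat_0_less_iff zero_less_Suc scaleR_one)
      qed
    qed
    then show "AE x in lebesgue. (\<lambda>m. F m x) \<longlonglongrightarrow> f x" by simp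
  qed (use f(1) in measurable)
  then have "\<forall>\<^sub>F m in sequentially. power_integral p v (\<lambda>x. F m x - f x) < ennreal \<delta>"
    using \<delta> by (intro order_tendstoD) auto
  then obtain m where m: "power_integral p v (\<lambda>x. F m x - f x) < ennreal \<delta>"
    using eventually_happens'[OF sequentially_bot] by blast
  define M where "M = real (Suc m)"
  have M: "M > 0" by (simp add: M_def)
  have "f measurable_on UNIV"
    using f(1) by (intro lebesgue_measurable_imp_measurable_on) auto
  then obtain N g where N: "negligible N" and g: "\<And>n. continuous_on UNIV (g n)"
    and lim: "\<And>x. x \<notin> N \<Longrightarrow> (\<lambda>n. g n x) \<longlonglongrightarrow> f x"
    unfolding measurable_on_def by auto
  define H where "H n x = cutoff M x *\<^sub>R radial_trunc M (g n x)" for n x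
  have H: "H n \<in> Cc" for n
  proof -
    have "{x. H n x \<noteq> 0} \<subseteq> ball 0 (M + 1)"
      using cutoff_props(4)[of M] by (force simp: H_def not_le)
    moreover have "continuous_on UNIV (H n)"
      unfolding H_def[abs_def]
      by (intro continuous_on_scaleR cutoff_props continuous_on_compose2[OF radial_trunc_props(4)[OF M] g]) auto
    ultimately show ?thesis
      unfolding Cc_def using bounded_subset[OF bounded_ball] by blast
  qed
  have "(\<lambda>n. power_integral p v (\<lambda>x. H n x - F m x)) \<longlonglongrightarrow> 0"
  proof (rule power_integral_tendsto_0[OF p v Cc_lebesgue[OF H] _, where G="\<lambda>x. of_real (2 * M * indicator (ball 0 (M + 1)) x)"])
    show "(\<lambda>x :: 'a. complex_of_real (2 * M * indicator (ball 0 (M + 1)) x)) \<in> borel_measurable lebesgue"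
    proof (rule borel_imp_lebesgue)
      have "indicat_real (ball 0 (M + 1)) \<in> borel_measurable (borel :: 'a measure)"
        by (intro borel_measurable_indicator) simp
      then have "(\<lambda>x :: 'a. 2 * M * indicator (ball 0 (M + 1)) x) \<in> borel_measurable borel"
        by (intro borel_measurable_times) auto
      moreover have "complex_of_real \<in> borel_measurable borel"
        by (intro borel_measurable_continuous_onI continuous_intros)
      ultimately show "(\<lambda>x :: 'a. complex_of_real (2 * M * indicator (ball 0 (M + 1)) x)) \<in> borel_measurable borel"
        by (rule measurable_compose)
    qed
    have "power_integral p v (\<lambda>x. complex_of_real (2 * M * indicator (ball 0 (M + 1)) x))
        = (\<integral>\<^sup>+x. ennreal ((2 * M) powr p) * (ennreal (v x) * indicator (ball 0 (M + 1)) x) \<partial>lborel)"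
      unfolding power_integral_def nn_integral_completion using M v(2) p
      by (intro nn_integral_cong) (auto simp: ennreal_mult less_imp_le norm_mult split: split_indicator)
    also have "\<dots> = ennreal ((2 * M) powr p) * (\<integral>\<^sup>+x. ennreal (v x) * indicator (ball 0 (M + 1)) x \<partial>lborel)"
    using measurable_weight_on_ball[OF v(1)] by (subst nn_integral_cmult) auto
    also have "\<dots> < top" using loc by (simp add: ennreal_mult_less_top)
    finally show "power_integral p v (\<lambda>x. complex_of_real (2 * M * indicator (ball 0 (M + 1)) x)) < top" .
    have "norm (c *\<^sub>R a - c *\<^sub>R b) \<le> 2 * M" if "norm a \<le> M" "norm b \<le> M" "0 \<le> c" "c \<le> 1" for a b :: complex and c
    proof -
      have "norm (c *\<^sub>R a - c *\<^sub>R b) = c * norm (a - b)"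
        using that by (simp flip: scaleR_diff_right)
      also have "\<dots> \<le> 1 * (M + M)"
        using that norm_triangle_ineq4[of a b] by (intro mult_mono) auto
      finally show ?thesis by simp
    qed
    note bd = this[OF radial_trunc_props(1)[OF M] radial_trunc_props(1)[OF M] cutoff_props(1,2)]
    have "norm (H n x - F m x) \<le> norm (complex_of_real (2 * M * indicator (ball 0 (M + 1)) x))" for n x
    proof (cases "norm x < M + 1")
      case True
      have "norm (H n x - F m x) \<le> 2 * M"
        unfolding H_def F_def M_def[symmetric] by (rule bd)
      then show ?thesis using True M by simp
    next
      case False
      then have "cutoff M x = 0" by (intro cutoff_props) simp
      then have "norm (H n x - F m x) = 0"
        unfolding H_def F_def M_def[symmetric] by simp
      then show ?thesis by (simp only: norm_ge_zero)
    qed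
    then show "AE x in lebesgue. norm (H n x - F m x) \<le> norm (complex_of_real (2 * M * indicator (ball 0 (M + 1)) x))" for n
      by simp
    have "AE x in lebesgue. x \<notin> N"
      using N by (intro AE_not_in) (simp add: negligible_iff_null_sets)
    then show "AE x in lebesgue. (\<lambda>n. H n x) \<longlonglongrightarrow> F m x"
    proof eventually_elim
      fix x assume "x \<notin> N"
      then have "(\<lambda>n. radial_trunc M (g n x)) \<longlonglongrightarrow> radial_trunc M (f x)"
        by (intro continuous_on_tendsto_compose[OF radial_trunc_props(4)[OF M]] lim) auto
      then show "(\<lambda>n. H n x) \<longlonglongrightarrow> F m x"
        unfolding H_def F_def M_def by (intro tendsto_intros)
    qed
  qed measurable
  then have "\<forall>\<^sub>F n in sequentially. power_integral p v (\<lambda>x. H n x - F m x) < ennreal \<delta>"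
    using \<delta> by (intro order_tendstoD) auto
  then obtain n where n: "power_integral p v (\<lambda>x. H n x - F m x) < ennreal \<delta>"
    using eventually_happens'[OF sequentially_bot] by blast
  have "power_integral p v (\<lambda>x. H n x - f x) = power_integral p v (\<lambda>x. (H n x - F m x) + (F m x - f x))" by simp
  also have "\<dots> \<le> ennreal (2 powr p) * (power_integral p v (\<lambda>x. H n x - F m x) + power_integral p v (\<lambda>x. F m x - f x))"
    using p v f(1) F Cc_lebesgue[OF H[of n]] by (intro power_integral_add_le borel_measurable_diff)
  also have "\<dots> \<le> ennreal (2 powr p) * (ennreal \<delta> + ennreal \<delta>)"
    using m n by (intro mult_left_mono add_mono) auto
  also have "\<dots> = ennreal e"
    using e by (simp add: \<delta>_def flip: ennreal_plus ennreal_mult)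
  finally show ?thesis using H by blast
qed

text \<open>
  Convergence of the power integrals is convergence in \<open>L^1\<close> of \<open>|h n - f|^p v\<close>, which yields convergence
  almost everywhere along a subsequence.
\<close>

lemma Cc_approximating_sequence:
  fixes v :: "'a::euclidean_space \<Rightarrow> real"
  assumes p: "p > 0" and v: "v \<in> borel_measurable borel" "\<And>x. v x > 0"
    and loc: "\<And>A. (\<integral>\<^sup>+x. ennreal (v x) * indicator (ball 0 A) x \<partial>lborel) < top"
    and f: "f \<in> borel_measurable lebesgue" "power_integral p v f < top"
  obtains h where "\<And>n. h n \<in> Cc" "(\<lambda>n. power_integral p v (\<lambda>x. h n x - f x)) \<longlonglongrightarrow> 0"
    "AE x in lebesgue. (\<lambda>n. h n x) \<longlonglongrightarrow> f x"
proof -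
  have "\<forall>n. \<exists>h\<in>Cc. power_integral p v (\<lambda>x. h x - f x) \<le> ennreal (inverse (real (Suc n)))"
    by (intro allI Cc_dense[OF p v loc f]) simp
  then obtain h where h: "\<And>n. h n \<in> Cc" "\<And>n. power_integral p v (\<lambda>x. h n x - f x) \<le> ennreal (inverse (real (Suc n)))"
    by metis
  note [measurable] = f(1) Cc_lebesgue[OF h(1)] borel_imp_lebesgue[OF v(1)]
  have lim: "(\<lambda>n. power_integral p v (\<lambda>x. h n x - f x)) \<longlonglongrightarrow> 0"
  proof (rule tendsto_sandwich[OF _ _ tendsto_const])
    show "(\<lambda>n. ennreal (inverse (real (Suc n)))) \<longlonglongrightarrow> 0"
      by (intro tendsto_ennreal_0 LIMSEQ_inverse_real_of_nat)
  qed (use h in auto)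
  define u where "u n x = norm (h n x - f x) powr p * v x" for n x
  have [measurable]: "u n \<in> borel_measurable lebesgue" for n unfolding u_def by measurable
  have u: "u n x \<ge> 0" for n x using v(2)[of x] by (simp add: u_def)
  have Lu: "power_integral p v (\<lambda>x. h n x - f x) = (\<integral>\<^sup>+x. ennreal (u n x) \<partial>lebesgue)" for n
    by (simp add: power_integral_def u_def)
  have "integrable lebesgue (u n)" for n
  proof (rule integrableI_nonneg)
    show "(\<integral>\<^sup>+x. ennreal (u n x) \<partial>lebesgue) < \<infinity>"
      using h(2)[of n] unfolding Lu by (auto intro: le_less_trans)
  qed (use u in auto)
  moreover have "(\<lambda>n. \<integral>x. norm (u n x) \<partial>lebesgue) \<longlonglongrightarrow> 0"
  proof -
    have "(\<integral>x. norm (u n x) \<partial>lebesgue) = enn2real (power_integral p v (\<lambda>x. h n x - f x))" for n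
      using u unfolding Lu by (subst integral_eq_nn_integral) auto
    then show ?thesis
      using tendsto_enn2real[of _ 0] lim by simp
  qed
  ultimately obtain r where r: "strict_mono r" "AE x in lebesgue. (\<lambda>n. u (r n) x) \<longlonglongrightarrow> 0"
    using tendsto_L1_AE_subseq[of lebesgue u] by blast
  show ?thesis
  proof (rule that[of "\<lambda>n. h (r n)"])
    show "(\<lambda>n. power_integral p v (\<lambda>x. h (r n) x - f x)) \<longlonglongrightarrow> 0"
      using LIMSEQ_subseq_LIMSEQ[OF lim r(1)] by (simp add: o_def)
    show "AE x in lebesgue. (\<lambda>n. h (r n) x) \<longlonglongrightarrow> f x"
      using r(2)
    proof eventually_elim
      fix x assume "(\<lambda>n. u (r n) x) \<longlonglongrightarrow> 0"
      from tendsto_mult_right[OF this, of "1 / v x"]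
      have "(\<lambda>n. norm (h (r n) x - f x) powr p) \<longlonglongrightarrow> 0"
        using v(2)[of x] by (simp add: u_def)
      then have "(\<lambda>n. (norm (h (r n) x - f x) powr p) powr (1 / p)) \<longlonglongrightarrow> 0"
        using p tendsto_powr'[of "\<lambda>n. norm (h (r n) x - f x) powr p" 0 sequentially "\<lambda>_. 1 / p" "1 / p"] by simp
      then have "(\<lambda>n. norm (h (r n) x - f x)) \<longlonglongrightarrow> 0"
        using p by (simp add: powr_powr)
      then show "(\<lambda>n. h (r n) x) \<longlonglongrightarrow> f x"
        using LIM_zero_cancel tendsto_norm_zero_iff by blast
    qed
  qed (use h in auto)
qed

section \<open>Passing to the limit in the mixed differences\<close>

text \<open>
  For fixed \<open>y\<close> the exceptional set in \<open>x\<close> is a translate of \<open>N\<close>; Tonelli's theorem exchanges the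
  quantifiers.  The maps \<open>T\<close> of interest include those that forget one of the two variables.
\<close>

lemma AE_translates_avoid_null_set:
  fixes T :: "'b::euclidean_space \<Rightarrow> 'a::euclidean_space"
  assumes N: "N \<in> null_sets lborel" and [measurable]: "T \<in> borel_measurable borel"
  shows "AE x in lborel. AE y in lborel. x - T y \<notin> N"
proof -
  have [measurable]: "N \<in> sets borel" using N by auto
  have "AE y in lborel. AE x in lborel. x - T y \<notin> N"
  proof (rule AE_I2)
    fix y
    have "{x. x - T y \<in> N} \<in> null_sets lborel" using N by (rule null_sets_translation)
    then show "AE x in lborel. x - T y \<notin> N" by (auto dest: AE_not_in)
  qed
  moreover have "{z \<in> space (lborel \<Otimes>\<^sub>M lborel). snd z - T (fst z) \<notin> N} \<in> sets (lborel \<Otimes>\<^sub>M lborel)"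
    by measurable
  ultimately show ?thesis
    by (simp only: lborel_pair.AE_commute)
qed

context box_weight begin

text \<open>
  Stated with the Lebesgue integral of a possibly nonmeasurable integrand on the left, since \<open>f\<close> is
  only Lebesgue measurable; the measurability required by Fatou's lemma is that of the \<open>h n\<close>.
\<close>

lemma mixed_osc_Fatou:
  assumes a: "a > 0" and s: "s > 0" and r: "r > 0" and h: "\<And>n. h n \<in> borel_measurable borel"
    and lim: "AE x in lebesgue. (\<lambda>n. h n x) \<longlonglongrightarrow> f x"
  shows "(\<integral>\<^sup>+x. epowr (eaverage (sum_ball 0 r) (\<lambda>y. epowr (ennreal (norm (mixed_diff y f x))) a)) s
      * ennreal (v x) \<partial>lebesgue) \<le> liminf (\<lambda>n. mixed_osc a s r (h n))"
proof -
  let ?B = "sum_ball 0 r :: ((real ^ 'm) \<times> (real ^ 'n)) set"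
  have B [measurable]: "?B \<in> sets borel" by (simp add: open_sum_ball)
  define E where "E n x = eaverage ?B (\<lambda>y. ennreal (norm (mixed_diff y (h n) x) powr a))" for n x
  have [measurable]: "E n \<in> borel_measurable borel" for n
    unfolding E_def[abs_def] using h by (rule measurable_eaverage_mixed_diff)
  have md [measurable]: "(\<lambda>y. mixed_diff y (h n) x) \<in> borel_measurable borel" for n x
    using h by (rule measurable_mixed_diff) auto
  have "AE x in lborel. (\<lambda>n. h n x) \<longlonglongrightarrow> f x"
    using lim by (simp add: AE_completion_iff)
  then obtain N where N: "N \<in> null_sets lborel" and conv: "\<And>x. x \<notin> N \<Longrightarrow> (\<lambda>n. h n x) \<longlonglongrightarrow> f x"
    by (auto elim!: AE_E3)
  have "AE x in lborel. (AE y in lborel. x - dilate 1 1 y \<notin> N) \<and> (AE y in lborel. x - dilate 1 0 y \<notin> N)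
      \<and> (AE y in lborel. x - dilate 0 1 y \<notin> N) \<and> (AE y in lborel. x - dilate 0 0 y \<notin> N)"
    by (intro AE_conjI AE_translates_avoid_null_set[OF N] measurable_dilate)
  then have "AE x in lborel. epowr (eaverage ?B (\<lambda>y. epowr (ennreal (norm (mixed_diff y f x))) a)) s * ennreal (v x)
      \<le> liminf (\<lambda>n. epowr (E n x) s * ennreal (v x))"
  proof eventually_elim
    case (elim x)
    then have "AE y in lborel. x - dilate 1 1 y \<notin> N \<and> x - dilate 1 0 y \<notin> N \<and> x - dilate 0 1 y \<notin> N \<and> x - dilate 0 0 y \<notin> N"
      by simp
    then have "AE y in lborel. epowr (ennreal (norm (mixed_diff y f x))) a * indicator ?B y
        = liminf (\<lambda>n. ennreal (norm (mixed_diff y (h n) x) powr a) * indicator ?B y)"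
    proof eventually_elim
      case (elim y)
      have "(\<lambda>n. mixed_diff y (h n) x) \<longlonglongrightarrow> mixed_diff y f x"
        using elim mixed_diff_dilate[of 1 y _ x] by (auto simp: dilate_1_1 intro!: tendsto_intros conv)
      then have "(\<lambda>n. norm (mixed_diff y (h n) x) powr a) \<longlonglongrightarrow> norm (mixed_diff y f x) powr a"
        using a by (intro tendsto_powr' tendsto_norm tendsto_const) auto
      then have "(\<lambda>n. ennreal (norm (mixed_diff y (h n) x) powr a) * indicator ?B y)
          \<longlonglongrightarrow> ennreal (norm (mixed_diff y f x) powr a) * indicator ?B y"
        by (auto split: split_indicator intro: tendsto_ennrealI)
      then show ?case
        using a by (simp add: epowr_ennreal lim_imp_Liminf)
    qed
    then have "(\<integral>\<^sup>+y. epowr (ennreal (norm (mixed_diff y f x))) a * indicator ?B y \<partial>lborel)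
        = (\<integral>\<^sup>+y. liminf (\<lambda>n. ennreal (norm (mixed_diff y (h n) x) powr a) * indicator ?B y) \<partial>lborel)"
      by (rule nn_integral_cong_AE)
    also have "\<dots> \<le> liminf (\<lambda>n. \<integral>\<^sup>+y. ennreal (norm (mixed_diff y (h n) x) powr a) * indicator ?B y \<partial>lborel)"
      by (intro nn_integral_liminf) measurable
    finally have "inverse (emeasure lborel ?B) * (\<integral>\<^sup>+y. epowr (ennreal (norm (mixed_diff y f x))) a * indicator ?B y \<partial>lborel)
        \<le> inverse (emeasure lborel ?B) * liminf (\<lambda>n. \<integral>\<^sup>+y. ennreal (norm (mixed_diff y (h n) x) powr a) * indicator ?B y \<partial>lborel)"
      by (rule mult_left_mono) simp
    moreover have "inverse (emeasure lborel ?B) < top"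
      using emeasure_sum_ball(2)[OF r, where 'm='m and 'n='n] by (simp add: less_top[symmetric] ennreal_inverse_eq_top_iff)
    ultimately have "eaverage ?B (\<lambda>y. epowr (ennreal (norm (mixed_diff y f x))) a) \<le> liminf (\<lambda>n. E n x)"
      by (simp add: E_def eaverage_lborel[OF B] divide_ennreal_def mult.commute[of _ "inverse _"] liminf_cmult_ennreal)
    then have "epowr (eaverage ?B (\<lambda>y. epowr (ennreal (norm (mixed_diff y f x))) a)) s \<le> liminf (\<lambda>n. epowr (E n x) s)"
      using s by (simp add: epowr_mono flip: epowr_Liminf)
    then have "ennreal (v x) * epowr (eaverage ?B (\<lambda>y. epowr (ennreal (norm (mixed_diff y f x))) a)) s
        \<le> ennreal (v x) * liminf (\<lambda>n. epowr (E n x) s)"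
      by (rule mult_left_mono) simp
    then show ?case
      by (simp add: liminf_cmult_ennreal mult.commute)
  qed
  then have "(\<integral>\<^sup>+x. epowr (eaverage ?B (\<lambda>y. epowr (ennreal (norm (mixed_diff y f x))) a)) s * ennreal (v x) \<partial>lborel)
      \<le> (\<integral>\<^sup>+x. liminf (\<lambda>n. epowr (E n x) s * ennreal (v x)) \<partial>lborel)"
    by (rule nn_integral_mono_AE)
  also have "\<dots> \<le> liminf (\<lambda>n. mixed_osc a s r (h n))"
    unfolding mixed_osc_def E_def[symmetric] using s by (intro nn_integral_liminf) measurable
  finally show ?thesis by (simp add: nn_integral_completion)
qed

end

section \<open>Finite nets in precompact sets\<close>

lemma Lp_norm_eq_power_integral:
  assumes p: "p > 0" and wv: "AE x in lebesgue. w x = ennreal (v x)" and v: "\<And>x. v x > 0"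
  shows "Lp_norm p w f = epowr (power_integral p v f) (1 / p)"
proof -
  have "(\<integral>\<^sup>+x. epowr (ennreal (norm (f x))) p * w x \<partial>lebesgue) = power_integral p v f"
    unfolding power_integral_def using wv
    by (intro nn_integral_cong_AE, eventually_elim)
      (use p v in \<open>simp add: epowr_ennreal ennreal_mult less_imp_le\<close>)
  then show ?thesis by (simp add: Lp_norm_def eLp_norm_def)
qed

text \<open>
  If \<open>D (k - g) < \<epsilon>\<close>, then \<open>\<eta>\<close> can be chosen with \<open>(1 + \<eta>)^p D (k - g) < \<epsilon>\<close>, and the gap leaves room for
  a perturbation of \<open>k\<close>.
\<close>

lemma openin_Lp_ball:
  assumes p: "p > 0" and wv: "AE x in lebesgue. w x = ennreal (v x)"
    and v: "v \<in> borel_measurable borel" "\<And>x. v x > 0" and g: "g \<in> Lp_space p w"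
  shows "openin (Lp_topology p w) {f \<in> Lp_space p w. power_integral p v (\<lambda>x. f x - g x) < ennreal \<epsilon>}"
  unfolding openin_Lp_topology
proof (intro conjI ballI)
  fix k assume "k \<in> {f \<in> Lp_space p w. power_integral p v (\<lambda>x. f x - g x) < ennreal \<epsilon>}"
  then have k: "k \<in> Lp_space p w" "power_integral p v (\<lambda>x. k x - g x) < ennreal \<epsilon>" by auto
  have meas: "f \<in> borel_measurable lebesgue" if "f \<in> Lp_space p w" for f
    using that by (simp add: Lp_space_def)
  obtain d where d: "power_integral p v (\<lambda>x. k x - g x) = ennreal d" "d \<ge> 0"
    using k(2) by (cases "power_integral p v (\<lambda>x. k x - g x)") auto
  then have "d < \<epsilon>" using k(2) by (simp add: ennreal_less_iff)
  have "((\<lambda>\<eta>. (1 + \<eta>) powr p * d) \<longlongrightarrow> (1 + 0) powr p * d) (at_right 0)"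
    by (intro tendsto_intros) auto
  then have "\<forall>\<^sub>F \<eta> in at_right 0. (1 + \<eta>) powr p * d < \<epsilon>"
    using \<open>d < \<epsilon>\<close> by (intro order_tendstoD) auto
  then have "\<forall>\<^sub>F \<eta> in at_right 0. (1 + \<eta>) powr p * d < \<epsilon> \<and> \<eta> > 0"
    using eventually_at_right_less[of 0] by (rule eventually_conj)
  then obtain \<eta> where \<eta>: "(1 + \<eta>) powr p * d < \<epsilon>" "\<eta> > 0"
    using eventually_happens'[OF trivial_limit_at_right_real] by blast
  define c where "c = (1 + 1 / \<eta>) powr p"
  define e where "e = (\<epsilon> - (1 + \<eta>) powr p * d) / c"
  have "1 + 1 / \<eta> > 0" using \<eta>(2) by (simp add: add_pos_pos)
  then have c: "c > 0" by (simp add: c_def)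
  have e: "e > 0" using \<eta> c by (simp add: e_def)
  have "j \<in> {f \<in> Lp_space p w. power_integral p v (\<lambda>x. f x - g x) < ennreal \<epsilon>}"
    if j: "j \<in> Lp_space p w" and "Lp_norm p w (\<lambda>x. j x - k x) < epowr (ennreal e) (1 / p)" for j
  proof -
    have "power_integral p v (\<lambda>x. j x - k x) < ennreal e"
      using that(2) p by (simp add: Lp_norm_eq_power_integral[OF p wv v(2)] epowr_less_iff)
    then obtain b where b: "power_integral p v (\<lambda>x. j x - k x) = ennreal b" "b \<ge> 0" "b < e"
      using e by (cases "power_integral p v (\<lambda>x. j x - k x)") (auto simp: ennreal_less_iff)
    have "power_integral p v (\<lambda>x. j x - g x) = power_integral p v (\<lambda>x. (k x - g x) + (j x - k x))" by simp
    also have "\<dots> \<le> ennreal ((1 + \<eta>) powr p) * power_integral p v (\<lambda>x. k x - g x) + ennreal c * power_integral p v (\<lambda>x. j x - k x)"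
      unfolding c_def using p \<eta>(2) v meas j k(1) g by (intro power_integral_split borel_measurable_diff) auto
    also have "\<dots> = ennreal ((1 + \<eta>) powr p * d + c * b)"
      using b d c by (simp add: ennreal_mult)
    also have "\<dots> < ennreal \<epsilon>"
    proof (rule ennreal_lessI)
      have "c * b < c * e" using b c by simp
      also have "c * e = \<epsilon> - (1 + \<eta>) powr p * d" using c by (simp add: e_def)
      finally show "(1 + \<eta>) powr p * d + c * b < \<epsilon>" by simp
      show "0 < \<epsilon>" using \<open>d < \<epsilon>\<close> d by simp
    qed
    finally show ?thesis using j by simp
  qed
  moreover have "epowr (ennreal e) (1 / p) > 0"
    using e p by (simp add: epowr_ennreal)
  ultimately show "\<exists>e>0. \<forall>j\<in>Lp_space p w. Lp_norm p w (\<lambda>x. j x - k x) < e \<longrightarrow>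
      j \<in> {f \<in> Lp_space p w. power_integral p v (\<lambda>x. f x - g x) < ennreal \<epsilon>}"
    by blast
qed auto

lemma precompact_totally_bounded:
  assumes p: "p > 0" and wv: "AE x in lebesgue. w x = ennreal (v x)"
    and v: "v \<in> borel_measurable borel" "\<And>x. v x > 0"
    and K: "precompact_in (Lp_topology p w) K" and \<epsilon>: "\<epsilon> > 0"
  obtains F where "finite F" "F \<subseteq> Lp_space p w" "\<And>f. f \<in> K \<Longrightarrow> \<exists>g\<in>F. power_integral p v (\<lambda>x. f x - g x) < ennreal \<epsilon>"
proof -
  let ?X = "Lp_topology p w" and ?U = "\<lambda>g. {f \<in> Lp_space p w. power_integral p v (\<lambda>x. f x - g x) < ennreal \<epsilon>}"
  let ?S = "?X closure_of K"
  have S: "?S \<subseteq> Lp_space p w"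
    using closure_of_subset_topspace[of ?X K] by (simp add: topspace_Lp_topology)
  have "g \<in> ?U g" if "g \<in> Lp_space p w" for g
    using that \<epsilon> by (simp add: power_integral_def)
  then have "?S \<subseteq> \<Union>(?U ` ?S)" using S by blast
  moreover have "\<forall>u\<in>?U ` ?S. openin ?X u"
    using openin_Lp_ball[OF p wv v] S by blast
  moreover have "compactin ?X ?S" using K by (simp add: precompact_in_def)
  ultimately obtain \<F> where \<F>: "finite \<F>" "\<F> \<subseteq> ?U ` ?S" "?S \<subseteq> \<Union>\<F>"
    unfolding compactin_def by meson
  from finite_subset_image[OF \<F>(1,2)] obtain F where F: "F \<subseteq> ?S" "finite F" "\<F> = ?U ` F"
    by blast
  have "K \<subseteq> ?S" using K by (simp add: precompact_in_def closure_of_subset)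
  show ?thesis
  proof (rule that[of F])
    show "\<exists>g\<in>F. power_integral p v (\<lambda>x. f x - g x) < ennreal \<epsilon>" if "f \<in> K" for f
      using that \<F>(3) F(3) \<open>K \<subseteq> ?S\<close> by blast
  qed (use F S in auto)
qed

lemma precompact_Cc_net:
  assumes p: "p > 0" and wv: "AE x in lebesgue. w x = ennreal (v x)"
    and v: "v \<in> borel_measurable borel" "\<And>x. v x > 0"
    and loc: "\<And>A. (\<integral>\<^sup>+x. ennreal (v x) * indicator (ball 0 A) x \<partial>lborel) < top"
    and K: "precompact_in (Lp_topology p w) K" and \<epsilon>: "\<epsilon> > 0"
  obtains H where "finite H" "H \<subseteq> Cc" "\<And>f. f \<in> K \<Longrightarrow> \<exists>h\<in>H. power_integral p v (\<lambda>x. f x - h x) \<le> ennreal \<epsilon>"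
proof -
  define \<delta> where "\<delta> = \<epsilon> / (2 * 2 powr p)"
  have \<delta>: "\<delta> > 0" using \<epsilon> by (simp add: \<delta>_def)
  obtain F where F: "finite F" "F \<subseteq> Lp_space p w" "\<And>f. f \<in> K \<Longrightarrow> \<exists>g\<in>F. power_integral p v (\<lambda>x. f x - g x) < ennreal \<delta>"
    using precompact_totally_bounded[OF p wv v K \<delta>] by blast
  have Lp: "f \<in> borel_measurable lebesgue" "power_integral p v f < top" if "f \<in> Lp_space p w" for f
    using that p by (auto simp: Lp_space_def Lp_norm_eq_power_integral[OF p wv v(2)] epowr_less_top_iff)
  have "\<forall>g\<in>F. \<exists>h\<in>Cc. power_integral p v (\<lambda>x. h x - g x) \<le> ennreal \<delta>"
    using F(2) Lp by (intro ballI Cc_dense[OF p v loc _ _ \<delta>]) auto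
  then obtain \<phi> where \<phi>: "\<And>g. g \<in> F \<Longrightarrow> \<phi> g \<in> Cc" "\<And>g. g \<in> F \<Longrightarrow> power_integral p v (\<lambda>x. \<phi> g x - g x) \<le> ennreal \<delta>"
    by metis
  have "K \<subseteq> Lp_space p w" using K by (simp add: precompact_in_def topspace_Lp_topology)
  show ?thesis
  proof (rule that[of "\<phi> ` F"])
    fix f assume f: "f \<in> K"
    then obtain g where g: "g \<in> F" "power_integral p v (\<lambda>x. f x - g x) < ennreal \<delta>" using F(3) by blast
    have meas: "f \<in> borel_measurable lebesgue" "g \<in> borel_measurable lebesgue" "\<phi> g \<in> borel_measurable lebesgue"
      using Lp(1) f g(1) \<open>K \<subseteq> Lp_space p w\<close> F(2) Cc_lebesgue[OF \<phi>(1)[OF g(1)]] by auto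
    have "power_integral p v (\<lambda>x. f x - \<phi> g x) = power_integral p v (\<lambda>x. (f x - g x) + (g x - \<phi> g x))" by simp
    also have "\<dots> \<le> ennreal (2 powr p) * (power_integral p v (\<lambda>x. f x - g x) + power_integral p v (\<lambda>x. g x - \<phi> g x))"
      using p v meas by (intro power_integral_add_le borel_measurable_diff)
    also have "\<dots> \<le> ennreal (2 powr p) * (ennreal \<delta> + ennreal \<delta>)"
      using g \<phi>(2)[OF g(1)] power_integral_commute[of p v "\<phi> g" g] by (intro mult_left_mono add_mono) auto
    also have "\<dots> = ennreal \<epsilon>"
      using \<epsilon> by (simp add: \<delta>_def flip: ennreal_plus ennreal_mult)
    finally show "\<exists>h\<in>\<phi> ` F. power_integral p v (\<lambda>x. f x - h x) \<le> ennreal \<epsilon>" using g(1) by blast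
  qed (use F(1) \<phi>(1) in auto)
qed

section \<open>Uniform estimates on precompact sets\<close>

lemma SUP_epowr_tendsto_0:
  assumes p: "p > 0"
    and small: "\<And>e. e > 0 \<Longrightarrow> \<forall>\<^sub>F A in F. \<forall>f\<in>K. I A f \<le> ennreal e"
  shows "((\<lambda>A. SUP f\<in>K. epowr (I A f) (1 / p)) \<longlongrightarrow> 0) F"
proof (rule order_tendstoI)
  fix b :: ennreal assume "0 < b"
  then obtain c where c: "0 < c" "c < b" using dense by blast
  then have "c < top" by (metis top.not_eq_extremum less_le_trans top_greatest)
  then obtain e where e: "c = ennreal e" "e > 0"
    using c(1) by (cases c) (auto simp: less_le)
  show "\<forall>\<^sub>F A in F. (SUP f\<in>K. epowr (I A f) (1 / p)) < b"
    using small[of "e powr p", simplified, OF e(2)[THEN less_imp_neq, THEN not_sym]]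
  proof eventually_elim
    fix A assume A: "\<forall>f\<in>K. I A f \<le> ennreal (e powr p)"
    have "epowr (I A f) (1 / p) \<le> c" if "f \<in> K" for f
    proof -
      have "epowr (I A f) (1 / p) \<le> epowr (ennreal (e powr p)) (1 / p)"
        using A that p by (intro epowr_mono) auto
      also have "\<dots> = c" using p e by (simp add: epowr_ennreal powr_powr)
      finally show ?thesis .
    qed
    then have "(SUP f\<in>K. epowr (I A f) (1 / p)) \<le> c" by (rule SUP_least)
    then show "(SUP f\<in>K. epowr (I A f) (1 / p)) < b" using c(2) by (rule le_less_trans)
  qed
qed simp

context box_weight begin

text \<open>
  For \<open>f\<close> near a member \<open>h\<close> of the net, and \<open>g n \<in> Cc\<close> tending to \<open>f\<close>, the difference \<open>g n - h\<close> is small and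
  belongs to \<open>Cc\<close>, so \<open>mixed_osc_le_power_integral\<close> bounds its mixed differences at every scale, while
  those of \<open>h\<close> are small for small \<open>r\<close>, uniformly over the finite net.  Then \<open>n\<close> tends to infinity.
\<close>

lemma mixed_osc_uniformly_small:
  fixes K :: "((real ^ 'm) \<times> (real ^ 'n) \<Rightarrow> complex) set"
  assumes a: "a > 0" and s: "s \<ge> q" and p: "p = a * s"
    and net: "\<And>e. e > 0 \<Longrightarrow> \<exists>H. finite H \<and> H \<subseteq> Cc \<and> (\<forall>f\<in>K. \<exists>h\<in>H. power_integral p v (\<lambda>x. f x - h x) \<le> ennreal e)"
    and K: "\<And>f. f \<in> K \<Longrightarrow> f \<in> borel_measurable lebesgue" "\<And>f. f \<in> K \<Longrightarrow> power_integral p v f < top"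
    and e: "e > 0"
  shows "\<forall>\<^sub>F r in at_right 0. \<forall>f\<in>K. (\<integral>\<^sup>+x. epowr (eaverage (sum_ball 0 r)
      (\<lambda>y. epowr (ennreal (norm (mixed_diff y f x))) a)) s * ennreal (v x) \<partial>lebesgue) \<le> ennreal e"
proof -
  have s0: "s > 0" and p0: "p > 0" using s q a p by auto
  obtain K1 where K1: "K1 < top" "\<And>r h. r > 0 \<Longrightarrow> h \<in> Cc \<Longrightarrow> mixed_osc a s r h \<le> K1 * power_integral p v h"
    using mixed_osc_le_power_integral[OF a s] unfolding p by blast
  obtain K2 where K2: "K2 < top" "\<And>r g h. g \<in> borel_measurable borel \<Longrightarrow> h \<in> borel_measurable borel \<Longrightarrow>
    mixed_osc a s r g \<le> K2 * (mixed_osc a s r (\<lambda>x. g x - h x) + mixed_osc a s r h)"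
    using mixed_osc_add_le[OF a s0] by blast
  obtain k1 k2 where k: "K1 = ennreal k1" "k1 \<ge> 0" "K2 = ennreal k2" "k2 \<ge> 0"
    using K1(1) K2(1) by (cases K1; cases K2) auto
  \<comment> \<open>the net is chosen so fine that the approximation error contributes at most \<open>e / 2\<close>\<close>
  define d where "d = e / (2 * (k2 + 1) * (k1 + 1) * (2 * 2 powr p))"
  define \<epsilon> where "\<epsilon> = e / (2 * (k2 + 1))"
  have d: "d > 0" and \<epsilon>: "\<epsilon> > 0" using e k by (auto simp: d_def \<epsilon>_def)
  obtain H where H: "finite H" "H \<subseteq> Cc" "\<And>f. f \<in> K \<Longrightarrow> \<exists>h\<in>H. power_integral p v (\<lambda>x. f x - h x) \<le> ennreal d"
    using net[OF d] by blast
  have "\<forall>\<^sub>F r in at_right 0. mixed_osc a s r h \<le> ennreal \<epsilon>" if "h \<in> H" for h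
  proof -
    have "h \<in> Cc" using H(2) that by blast
    from mixed_osc_Cc_small[OF a s0 this \<epsilon>] obtain \<delta> where "\<delta> > 0" "\<And>r. 0 < r \<Longrightarrow> r < \<delta> \<Longrightarrow> mixed_osc a s r h \<le> ennreal \<epsilon>"
      by blast
    then show ?thesis by (auto simp: eventually_at_right_field)
  qed
  then have "\<forall>\<^sub>F r in at_right 0. \<forall>h\<in>H. mixed_osc a s r h \<le> ennreal \<epsilon>"
    using H(1) by (simp add: eventually_ball_finite)
  then show ?thesis using eventually_at_right_less[of 0]
  proof eventually_elim
    fix r :: real assume osc_on_net: "\<forall>h\<in>H. mixed_osc a s r h \<le> ennreal \<epsilon>" and r: "0 < r"
    show "\<forall>f\<in>K. (\<integral>\<^sup>+x. epowr (eaverage (sum_ball 0 r)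
      (\<lambda>y. epowr (ennreal (norm (mixed_diff y f x))) a)) s * ennreal (v x) \<partial>lebesgue) \<le> ennreal e"
    proof
      fix f assume f: "f \<in> K"
      obtain h where h: "h \<in> H" "power_integral p v (\<lambda>x. f x - h x) \<le> ennreal d" using H(3)[OF f] by blast
      have hC: "h \<in> Cc" using h H(2) by blast
      obtain g where g: "\<And>n. g n \<in> Cc" "(\<lambda>n. power_integral p v (\<lambda>x. g n x - f x)) \<longlonglongrightarrow> 0"
          "AE x in lebesgue. (\<lambda>n. g n x) \<longlonglongrightarrow> f x"
        using Cc_approximating_sequence[OF p0 v v_pos weight_ball_finite K[OF f]] by blast
      have "\<forall>\<^sub>F n in sequentially. power_integral p v (\<lambda>x. g n x - f x) < ennreal d"
        using g(2) d by (intro order_tendstoD) auto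
      then have "\<forall>\<^sub>F n in sequentially. mixed_osc a s r (g n) \<le> ennreal e"
      proof eventually_elim
        fix n assume n: "power_integral p v (\<lambda>x. g n x - f x) < ennreal d"
        have "power_integral p v (\<lambda>x. g n x - h x) = power_integral p v (\<lambda>x. (g n x - f x) + (f x - h x))" by simp
        also have "\<dots> \<le> ennreal (2 powr p) * (power_integral p v (\<lambda>x. g n x - f x) + power_integral p v (\<lambda>x. f x - h x))"
          using p0 v v_pos K(1)[OF f] Cc_lebesgue[OF g(1)[of n]] Cc_lebesgue[OF hC]
          by (intro power_integral_add_le borel_measurable_diff)
        also have "\<dots> \<le> ennreal (2 powr p) * (ennreal d + ennreal d)"
          using n h(2) by (intro mult_left_mono add_mono) auto
        finally have gh: "power_integral p v (\<lambda>x. g n x - h x) \<le> ennreal (2 * 2 powr p * d)"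
          using d by (simp add: mult_ac flip: ennreal_plus ennreal_mult)
        have "mixed_osc a s r (g n) \<le> K2 * (mixed_osc a s r (\<lambda>x. g n x - h x) + mixed_osc a s r h)"
          by (intro K2(2) Cc_borel g hC)
        also have "\<dots> \<le> K2 * (K1 * ennreal (2 * 2 powr p * d) + ennreal \<epsilon>)"
          using osc_on_net h(1) order_trans[OF K1(2)[OF r Cc_diff[OF g(1)[of n] hC]] mult_left_mono[OF gh]]
          by (intro mult_left_mono add_mono) auto
        also have "\<dots> = ennreal (k2 * (k1 * (2 * 2 powr p * d) + \<epsilon>))"
          using k d \<epsilon> by (simp flip: ennreal_plus ennreal_mult)
        also have "\<dots> \<le> ennreal e"
        proof (rule ennreal_leI)
          have "(k1 + 1) * (2 * 2 powr p * d) = \<epsilon>"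
            using k(2,4) by (simp add: d_def \<epsilon>_def field_simps add_nonneg_eq_0_iff)
          moreover have "k1 * (2 * 2 powr p * d) \<le> (k1 + 1) * (2 * 2 powr p * d)"
            using d by (intro mult_right_mono) auto
          ultimately have "k2 * (k1 * (2 * 2 powr p * d) + \<epsilon>) \<le> (k2 + 1) * (\<epsilon> + \<epsilon>)"
            using k \<epsilon> d by (intro mult_mono) auto
          also have "\<dots> = e" using k by (simp add: \<epsilon>_def field_simps add_nonneg_eq_0_iff)
          finally show "k2 * (k1 * (2 * 2 powr p * d) + \<epsilon>) \<le> e" .
        qed
        finally show "mixed_osc a s r (g n) \<le> ennreal e" .
      qed
      then have "liminf (\<lambda>n. mixed_osc a s r (g n)) \<le> liminf (\<lambda>n::nat. ennreal e)"
        by (rule Liminf_mono)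
      then have "liminf (\<lambda>n. mixed_osc a s r (g n)) \<le> ennreal e" by (simp add: Liminf_const)
      with mixed_osc_Fatou[OF a s0 r Cc_borel[OF g(1)] g(3)]
      show "(\<integral>\<^sup>+x. epowr (eaverage (sum_ball 0 r)
        (\<lambda>y. epowr (ennreal (norm (mixed_diff y f x))) a)) s * ennreal (v x) \<partial>lebesgue) \<le> ennreal e"
        by (rule order_trans)
    qed
  qed
qed

end

theorem theorem6p4:
  fixes w :: "(real ^ 'n1) \<times> (real ^ 'n2) \<Rightarrow> ennreal"
    and \<K> :: "((real ^ 'n1) \<times> (real ^ 'n2) \<Rightarrow> complex) set"
    and p p0 a :: real
  assumes "1 < p0"
    and "w \<in> product_Ap p0"
    and "0 < p"
    and "\<K> \<subseteq> Lp_space p w"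
    and "0 < a" and "a \<le> p / p0"
    and "precompact_in (Lp_topology p w) \<K>"
  shows "(SUP f\<in>\<K>. Lp_norm p w f) < top \<and>
    ((\<lambda>A. SUP f\<in>\<K>. Lp_norm p w (\<lambda>x. indicator (- sum_ball 0 A) x *\<^sub>R f x))
       \<longlongrightarrow> 0) at_top \<and>
    ((\<lambda>r. SUP f\<in>\<K>. eLp_norm p w (\<lambda>x.
         epowr (eaverage (sum_ball 0 r)
                  (\<lambda>y. epowr (ennreal (norm (mixed_diff y f x))) a)) (1 / a)))
       \<longlongrightarrow> 0) (at_right 0)"
proof -
  note p = \<open>0 < p\<close>
  obtain v C where "box_weight v p0 C" and wv: "AE x in lebesgue. w x = ennreal (v x)"
    using product_Ap_imp_box_weight[OF assms(1,2)] by blast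
  interpret box_weight v p0 C by fact
  note Lp = Lp_norm_eq_power_integral[OF p wv v_pos]
  have K: "f \<in> borel_measurable lebesgue" "power_integral p v f < top" if "f \<in> \<K>" for f
    using that assms(4) p by (auto simp: Lp_space_def Lp epowr_less_top_iff)
  have net: "\<exists>H. finite H \<and> H \<subseteq> Cc \<and> (\<forall>f\<in>\<K>. \<exists>h\<in>H. power_integral p v (\<lambda>x. f x - h x) \<le> ennreal e)" if "e > 0" for e
    using precompact_Cc_net[OF p wv v v_pos weight_ball_finite assms(7) that] by metis
  have a: "(SUP f\<in>\<K>. Lp_norm p w f) < top"
  proof -
    obtain H where H: "finite H" "H \<subseteq> Cc" "\<And>f. f \<in> \<K> \<Longrightarrow> \<exists>h\<in>H. power_integral p v (\<lambda>x. f x - h x) \<le> ennreal 1"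
      using net[of 1] by auto
    define B where "B = ennreal (2 powr p) * (1 + (\<Sum>h\<in>H. power_integral p v h))"
    have "power_integral p v h < top" if "h \<in> H" for h
      using Cc_power_integral_finite[OF p v v_pos weight_ball_finite] H(2) that by blast
    then have "(\<Sum>h\<in>H. power_integral p v h) \<noteq> top"
      using H(1) by (auto simp: less_top)
    then have B: "B < top" by (simp add: B_def ennreal_mult_less_top less_top)
    have "power_integral p v f \<le> B" if f: "f \<in> \<K>" for f
    proof -
      obtain h where h: "h \<in> H" "power_integral p v (\<lambda>x. f x - h x) \<le> 1" using H(3)[OF f] by auto
      have hm: "h \<in> borel_measurable lebesgue" using h H(2) Cc_lebesgue by blast
      have "power_integral p v f = power_integral p v (\<lambda>x. (f x - h x) + h x)" by simp
      also have "\<dots> \<le> ennreal (2 powr p) * (power_integral p v (\<lambda>x. f x - h x) + power_integral p v h)"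
        using p v v_pos K(1)[OF f] hm by (intro power_integral_add_le borel_measurable_diff)
      also have "\<dots> \<le> B"
        unfolding B_def using h H(1) by (intro mult_left_mono add_mono member_le_sum) auto
      finally show ?thesis .
    qed
    then have "(SUP f\<in>\<K>. Lp_norm p w f) \<le> epowr B (1 / p)"
      unfolding Lp using p by (intro SUP_least epowr_mono) auto
    also have "\<dots> < top" using B p by (simp add: epowr_less_top_iff)
    finally show ?thesis .
  qed
  have b: "((\<lambda>A. SUP f\<in>\<K>. Lp_norm p w (\<lambda>x. indicator (- sum_ball 0 A) x *\<^sub>R f x)) \<longlongrightarrow> 0) at_top"
    unfolding Lp
  proof (rule SUP_epowr_tendsto_0[OF p])
    fix e :: real assume e: "e > 0"
    obtain H where H: "finite H" "H \<subseteq> Cc" "\<And>f. f \<in> \<K> \<Longrightarrow> \<exists>h\<in>H. power_integral p v (\<lambda>x. f x - h x) \<le> ennreal e"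
      using net[OF e] by auto
    have "\<forall>\<^sub>F A in at_top. \<forall>x. h x \<noteq> 0 \<longrightarrow> x \<in> sum_ball 0 A" if "h \<in> H" for h
    proof -
      have "bounded {x. h x \<noteq> 0}" using H(2) that by (auto simp: Cc_def)
      then obtain R where R: "\<And>x. h x \<noteq> 0 \<Longrightarrow> norm x \<le> R"
        unfolding bounded_iff by blast
      show ?thesis
        using eventually_gt_at_top[of "2 * R"]
      proof (eventually_elim, intro allI impI)
        fix A x assume "2 * R < A" "h x \<noteq> 0"
        moreover have "norm (fst x) \<le> norm x" "norm (snd x) \<le> norm x"
          by (metis norm_fst_le prod.collapse, metis norm_snd_le prod.collapse)
        ultimately show "x \<in> sum_ball 0 A" using R[of x] by (simp add: sum_ball_def)
      qed
    qed
    then have "\<forall>\<^sub>F A in at_top. \<forall>h\<in>H. \<forall>x. h x \<noteq> 0 \<longrightarrow> x \<in> sum_ball 0 A"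
      using H(1) by (simp add: eventually_ball_finite)
    then show "\<forall>\<^sub>F A in at_top. \<forall>f\<in>\<K>. power_integral p v (\<lambda>x. indicator (- sum_ball 0 A) x *\<^sub>R f x) \<le> ennreal e"
    proof eventually_elim
      fix A :: real assume A: "\<forall>h\<in>H. \<forall>x. h x \<noteq> 0 \<longrightarrow> x \<in> sum_ball 0 A"
      show "\<forall>f\<in>\<K>. power_integral p v (\<lambda>x. indicator (- sum_ball 0 A) x *\<^sub>R f x) \<le> ennreal e"
      proof
        fix f assume "f \<in> \<K>"
        then obtain h where h: "h \<in> H" "power_integral p v (\<lambda>x. f x - h x) \<le> ennreal e" using H(3) by blast
        have "norm (indicator (- sum_ball 0 A) x *\<^sub>R f x) \<le> norm (f x - h x)" for x
        proof (cases "x \<in> sum_ball 0 A")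
          case False
          then have "h x = 0" using A h(1) by blast
          then show ?thesis by (simp add: indicator_def)
        qed simp
        then have "power_integral p v (\<lambda>x. indicator (- sum_ball 0 A) x *\<^sub>R f x) \<le> power_integral p v (\<lambda>x. f x - h x)"
          unfolding power_integral_def using p v_pos
          by (intro nn_integral_mono ennreal_leI mult_right_mono powr_mono2) (auto simp: less_imp_le)
        then show "power_integral p v (\<lambda>x. indicator (- sum_ball 0 A) x *\<^sub>R f x) \<le> ennreal e"
          using h(2) by (rule order_trans)
      qed
    qed
  qed
  have c: "((\<lambda>r. SUP f\<in>\<K>. eLp_norm p w (\<lambda>x. epowr (eaverage (sum_ball 0 r)
      (\<lambda>y. epowr (ennreal (norm (mixed_diff y f x))) a)) (1 / a))) \<longlongrightarrow> 0) (at_right 0)"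
  proof -
    have eq: "eLp_norm p w (\<lambda>x. epowr (E x) (1 / a)) = epowr (\<integral>\<^sup>+x. epowr (E x) (p / a) * ennreal (v x) \<partial>lebesgue) (1 / p)" for E
    proof -
      have "(\<integral>\<^sup>+x. epowr (epowr (E x) (1 / a)) p * w x \<partial>lebesgue) = (\<integral>\<^sup>+x. epowr (E x) (p / a) * ennreal (v x) \<partial>lebesgue)"
        using wv by (intro nn_integral_cong_AE, eventually_elim) (use p assms(5) in \<open>simp add: epowr_epowr\<close>)
      then show ?thesis by (simp add: eLp_norm_def)
    qed
    have s: "p / a \<ge> p0" "p = a * (p / a)"
      using assms(1,5,6) by (auto simp: field_simps)
    show ?thesis
      unfolding eq
    proof (rule SUP_epowr_tendsto_0[OF p])
      fix e :: real assume "e > 0"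
      from mixed_osc_uniformly_small[OF \<open>0 < a\<close> s net K this]
      show "\<forall>\<^sub>F r in at_right 0. \<forall>f\<in>\<K>. (\<integral>\<^sup>+x. epowr (eaverage (sum_ball 0 r)
          (\<lambda>y. epowr (ennreal (norm (mixed_diff y f x))) a)) (p / a) * ennreal (v x) \<partial>lebesgue) \<le> ennreal e"
        by simp
    qed
  qed
  show ?thesis using a b c by blast
qed

end
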